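(* Let $K$ be an inversive difference field with basic set $\sigma=\{\alpha_1,\alpha_2\}$ whose elements are functions $f(x,t)$, with $\alpha_1:f(x,t)\mapsto f(x+1,t)$ and $\alpha_2:f(x,t)\mapsto f(x,t+1)$, and let $K\{y\}^*$ be the ring of $\sigma^*$-polynomials in one $\sigma^*$-indeterminate $y$ over $K$. Consider difference schemes for the diffusion equation $\frac{\partial u}{\partial t}=a\frac{\partial^2u}{\partial x^2}$ with a constant diffusion coefficient $a\in K$, where $y$ stands for $u$. (1) (Forward scheme.) The $\sigma^*$-dimension polynomial of the equation $$a\alpha_1^2y-2a\alpha_1y-\alpha_2y+(a+1)y=0$$ is $\psi_{Forw}(t)=5t$. (2) (Symmetric scheme.) The $\sigma^*$-dimension polynomial of the equation $$a\alpha_1y+a\alpha_1^{-1}y-\alpha_2y+\alpha_2^{-1}y-2ay=0$$ is $\psi_{Symm}(t)=4t$. (3) (Crank-Nicholson scheme.) The scheme gives an equation of the form $$\alpha_1\alpha_2y+a_1\alpha_1^{-1}\alpha_2y+a_2\alpha_1y+a_3\alpha_2y+a_4\alpha_1^{-1}y+a_5=0,$$ where $a_1,\dots,a_5$ are constants, and its $\sigma^*$-dimension polynomial is $\psi_{Crank\text{-}Nicholson}(t)=6t-1$. Thus the symmetric difference scheme for the diffusion equation has higher strength (that is, smaller $\sigma^*$-dimension polynomial) than the forward difference scheme and the Crank-Nicholson scheme, so it is the best of the three from the point of view of Einstein's strength.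
   Context: All fields have characteristic zero. An inversive difference field with basic set $\sigma=\{\alpha_1,\alpha_2\}$ is a field with commuting automorphisms $\alpha_1,\alpha_2$. A constant is an element fixed by $\alpha_1$ and $\alpha_2$. $\Gamma$ is the free commutative group of all $\gamma=\alpha_1^{i_1}\alpha_2^{i_2}$ ($i_1,i_2\in\mathbb Z$), $\mathrm{ord}\,\gamma=|i_1|+|i_2|$, and $\Gamma(r)=\{\gamma\in\Gamma:\mathrm{ord}\,\gamma\le r\}$. $K\{y_1,\dots,y_n\}^*$ is the polynomial ring over $K$ in the algebraically independent indeterminates $\gamma y_i$ ($\gamma\in\Gamma$, $1\le i\le n$), on which $\Gamma$ acts by $\gamma'(\gamma y_i)=(\gamma'\gamma)y_i$ and by the given action on coefficients. A system of equations $A_1=0,\dots,A_q=0$ with $A_i\in K\{y_1,\dots,y_n\}^*$ is prime if the ideal $P=[A_1,\dots,A_q]^*$ generated by all $\gamma A_i$ ($\gamma\in\Gamma$, $1\le i\le q$) is prime. Let then $L$ be the quotient field of $K\{y_1,\dots,y_n\}^*/P$ and $\eta_i$ the image of $y_i$. The $\sigma^*$-dimension polynomial of the system is the unique polynomial $\psi(t)\in\mathbb Q[t]$ such that $\psi(r)=\mathrm{tr.deg}_K K(\{\gamma\eta_i:\gamma\in\Gamma(r),\,1\le i\le n\})$ for all sufficiently large integers $r$ (it exists for every prime system). Saying that a system has a given $\sigma^*$-dimension polynomial includes the assertion that the system is prime. This polynomial expresses Einstein's strength of the system. Polynomials are compared by $f<g$ if and only if $f(r)<g(r)$ for all sufficiently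 large integers $r$.
   Formalization: It is assumed that a≠0, and a≠−1 in (1) and in the comparison with the forward scheme (5t fails there); the Crank-Nicholson scheme's last term is a_5y, not a_5; for general coefficients (either last term) a_1, a_2, a_4 are nonzero. *)

theory Defs
  imports
    "HOL-Algebra.Algebra"
    "HOL-Algebra.Algebraic_Closure_Type"
    "HOL-Library.Poly_Mapping"
    "HOL-Library.Product_Plus"
    "HOL-Computational_Algebra.Polynomial"
begin

section \<open>Inversive difference fields and the group \<open>\<Gamma>\<close>\<close>

definition field_automorphism :: "('k::field \<Rightarrow> 'k) \<Rightarrow> bool" where
  "field_automorphism f \<longleftrightarrow> bij f \<and> f 1 = 1 \<and>
     (\<forall>x y. f (x + y) = f x + f y) \<and> (\<forall>x y. f (x * y) = f x * f y)"

definition inversive_difference_field ::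
    "('k::field_char_0 \<Rightarrow> 'k) \<Rightarrow> ('k \<Rightarrow> 'k) \<Rightarrow> bool" where
  "inversive_difference_field \<alpha>1 \<alpha>2 \<longleftrightarrow>
     field_automorphism \<alpha>1 \<and> field_automorphism \<alpha>2 \<and> \<alpha>1 \<circ> \<alpha>2 = \<alpha>2 \<circ> \<alpha>1"

definition is_constant :: "('k \<Rightarrow> 'k) \<Rightarrow> ('k \<Rightarrow> 'k) \<Rightarrow> 'k \<Rightarrow> bool" where
  "is_constant \<alpha>1 \<alpha>2 c \<longleftrightarrow> \<alpha>1 c = c \<and> \<alpha>2 c = c"

text \<open>The pair \<open>(i, j)\<close> encodes \<open>\<alpha>1\<^sup>i \<alpha>2\<^sup>j\<close>, so the group operation of \<open>\<Gamma>\<close> is addition of pairs.\<close>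

type_synonym shift = "int \<times> int"

definition shift_ord :: "shift \<Rightarrow> nat" where
  "shift_ord \<gamma> = nat (\<bar>fst \<gamma>\<bar> + \<bar>snd \<gamma>\<bar>)"

definition shift_ball :: "nat \<Rightarrow> shift set" where
  "shift_ball r = {\<gamma>. shift_ord \<gamma> \<le> r}"

definition int_iterate :: "('k \<Rightarrow> 'k) \<Rightarrow> int \<Rightarrow> 'k \<Rightarrow> 'k" where
  "int_iterate f i = (if i \<ge> 0 then f ^^ nat i else inv_into UNIV f ^^ nat (- i))"

definition shift_coeff :: "('k \<Rightarrow> 'k) \<Rightarrow> ('k \<Rightarrow> 'k) \<Rightarrow> shift \<Rightarrow> 'k \<Rightarrow> 'k" where
  "shift_coeff \<alpha>1 \<alpha>2 \<gamma> = int_iterate \<alpha>1 (fst \<gamma>) \<circ> int_iterate \<alpha>2 (snd \<gamma>)"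


section \<open>The ring of \<open>\<sigma>\<^sup>*\<close>-polynomials\<close>

text \<open>The polynomial ring over \<open>'k\<close> in the indeterminates \<open>'v\<close> is the type
  \<open>('v \<Rightarrow>\<^sub>0 nat) \<Rightarrow>\<^sub>0 'k\<close>: finitely supported coefficient functions on the
  finitely supported exponent functions. The indeterminate \<open>\<gamma> y\<^sub>i\<close> is indexed by the
  pair \<open>(\<gamma>, i)\<close>, where \<open>i\<close> ranges over a finite type \<open>'n\<close>.\<close>

type_synonym ('k, 'v) mpoly = "('v \<Rightarrow>\<^sub>0 nat) \<Rightarrow>\<^sub>0 'k"
type_synonym ('k, 'n) sigma_poly = "('k, shift \<times> 'n) mpoly"

definition Const :: "'k::comm_ring_1 \<Rightarrow> ('k, 'v) mpoly" where
  "Const c = Poly_Mapping.single 0 c"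

definition Var :: "'v \<Rightarrow> ('k::comm_ring_1, 'v) mpoly" where
  "Var v = Poly_Mapping.single (Poly_Mapping.single v 1) 1"

definition shift_poly :: "('k::field_char_0 \<Rightarrow> 'k) \<Rightarrow> ('k \<Rightarrow> 'k) \<Rightarrow> shift \<Rightarrow>
    ('k, 'n) sigma_poly \<Rightarrow> ('k, 'n) sigma_poly" where
  "shift_poly \<alpha>1 \<alpha>2 \<gamma> p =
     (\<Sum>m\<in>Poly_Mapping.keys p.
        Const (shift_coeff \<alpha>1 \<alpha>2 \<gamma> (Poly_Mapping.lookup p m)) *
        (\<Prod>v\<in>Poly_Mapping.keys m. Var (\<gamma> + fst v, snd v) ^ Poly_Mapping.lookup m v))"

abbreviation sigma_ring :: "('k::field_char_0, 'n) sigma_poly ring" where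
  "sigma_ring \<equiv> ring_of_type_algebra"

definition sigma_ideal :: "('k::field_char_0 \<Rightarrow> 'k) \<Rightarrow> ('k \<Rightarrow> 'k) \<Rightarrow>
    ('k, 'n) sigma_poly set \<Rightarrow> ('k, 'n) sigma_poly set" where
  "sigma_ideal \<alpha>1 \<alpha>2 S = genideal sigma_ring {shift_poly \<alpha>1 \<alpha>2 \<gamma> A |\<gamma> A. A \<in> S}"

text \<open>A finite set \<open>S\<close> stands for the system of the equations \<open>A = 0\<close>, \<open>A \<in> S\<close>.\<close>

definition prime_system :: "('k::field_char_0 \<Rightarrow> 'k) \<Rightarrow> ('k \<Rightarrow> 'k) \<Rightarrow>
    ('k, 'n) sigma_poly set \<Rightarrow> bool" where
  "prime_system \<alpha>1 \<alpha>2 S \<longleftrightarrow> finite S \<and> primeideal (sigma_ideal \<alpha>1 \<alpha>2 S) sigma_ring"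


section \<open>Quotient fields\<close>

text \<open>\<open>fraction D a b\<close> is the class of all pairs that represent the fraction \<open>a / b\<close>. The
  operations of the quotient field are unions over representatives, as in \<^const>\<open>rcoset_mult\<close>.\<close>

definition fraction :: "('a, 'b) ring_scheme \<Rightarrow> 'a \<Rightarrow> 'a \<Rightarrow> ('a \<times> 'a) set" where
  "fraction D a b = {(c, d). c \<in> carrier D \<and> d \<in> carrier D - {\<zero>\<^bsub>D\<^esub>} \<and>
                             a \<otimes>\<^bsub>D\<^esub> d = c \<otimes>\<^bsub>D\<^esub> b}"

definition quotient_field :: "('a, 'b) ring_scheme \<Rightarrow> ('a \<times> 'a) set ring" where
  "quotient_field D =
     \<lparr>carrier = {fraction D a b |a b. a \<in> carrier D \<and> b \<in> carrier D - {\<zero>\<^bsub>D\<^esub>}},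
      monoid.mult = (\<lambda>U V. \<Union>(a, b)\<in>U. \<Union>(c, d)\<in>V. fraction D (a \<otimes>\<^bsub>D\<^esub> c) (b \<otimes>\<^bsub>D\<^esub> d)),
      one = fraction D \<one>\<^bsub>D\<^esub> \<one>\<^bsub>D\<^esub>,
      ring.zero = fraction D \<zero>\<^bsub>D\<^esub> \<one>\<^bsub>D\<^esub>,
      add = (\<lambda>U V. \<Union>(a, b)\<in>U. \<Union>(c, d)\<in>V.
               fraction D ((a \<otimes>\<^bsub>D\<^esub> d) \<oplus>\<^bsub>D\<^esub> (c \<otimes>\<^bsub>D\<^esub> b)) (b \<otimes>\<^bsub>D\<^esub> d))\<rparr>"

definition to_quotient_field :: "('a, 'b) ring_scheme \<Rightarrow> 'a \<Rightarrow> ('a \<times> 'a) set" where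
  "to_quotient_field D a = fraction D a \<one>\<^bsub>D\<^esub>"


section \<open>Transcendence degree\<close>

text \<open>A field \<open>L\<close> is an extension of the field \<open>'k\<close> through a homomorphism
  \<open>h :: 'k \<Rightarrow> 'l\<close>, i.e. \<open>range h\<close> is the copy of the ground field inside \<open>L\<close>.\<close>

definition mpoly_eval :: "('l, 'b) ring_scheme \<Rightarrow> ('k::field \<Rightarrow> 'l) \<Rightarrow> ('v \<Rightarrow> 'l) \<Rightarrow>
    ('k, 'v) mpoly \<Rightarrow> 'l" where
  "mpoly_eval L h x p =
     finsum L (\<lambda>m. h (Poly_Mapping.lookup p m) \<otimes>\<^bsub>L\<^esub>
                   finprod L (\<lambda>v. x v [^]\<^bsub>L\<^esub> Poly_Mapping.lookup m v) (Poly_Mapping.keys m))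
       (Poly_Mapping.keys p)"

definition algebraically_independent ::
    "('l, 'b) ring_scheme \<Rightarrow> ('k::field \<Rightarrow> 'l) \<Rightarrow> 'l set \<Rightarrow> bool" where
  "algebraically_independent L h B \<longleftrightarrow>
     (\<forall>p :: ('k, 'l) mpoly.
        (\<forall>m\<in>Poly_Mapping.keys p. Poly_Mapping.keys m \<subseteq> B) \<and>
        mpoly_eval L h (\<lambda>b. b) p = \<zero>\<^bsub>L\<^esub> \<longrightarrow> p = 0)"

definition transcendence_basis ::
    "('l, 'b) ring_scheme \<Rightarrow> ('k::field \<Rightarrow> 'l) \<Rightarrow> 'l set \<Rightarrow> 'l set \<Rightarrow> bool" where
  "transcendence_basis L h E B \<longleftrightarrow>
     B \<subseteq> E \<and> algebraically_independent L h B \<and>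
     (\<forall>x\<in>E. ring.algebraic L (generate_field L (range h \<union> B)) x)"

definition has_trdeg ::
    "('l, 'b) ring_scheme \<Rightarrow> ('k::field \<Rightarrow> 'l) \<Rightarrow> 'l set \<Rightarrow> nat \<Rightarrow> bool" where
  "has_trdeg L h E n \<longleftrightarrow> (\<exists>B. transcendence_basis L h E B \<and> finite B \<and> card B = n)"


section \<open>\<open>\<sigma>\<^sup>*\<close>-dimension polynomials and strength\<close>

definition system_ring :: "('k::field_char_0 \<Rightarrow> 'k) \<Rightarrow> ('k \<Rightarrow> 'k) \<Rightarrow>
    ('k, 'n) sigma_poly set \<Rightarrow> ('k, 'n) sigma_poly set ring" where
  "system_ring \<alpha>1 \<alpha>2 S = sigma_ring Quot sigma_ideal \<alpha>1 \<alpha>2 S"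

definition system_map :: "('k::field_char_0 \<Rightarrow> 'k) \<Rightarrow> ('k \<Rightarrow> 'k) \<Rightarrow>
    ('k, 'n) sigma_poly set \<Rightarrow> ('k, 'n) sigma_poly \<Rightarrow>
    (('k, 'n) sigma_poly set \<times> ('k, 'n) sigma_poly set) set" where
  "system_map \<alpha>1 \<alpha>2 S p =
     to_quotient_field (system_ring \<alpha>1 \<alpha>2 S) (sigma_ideal \<alpha>1 \<alpha>2 S +>\<^bsub>sigma_ring\<^esub> p)"

text \<open>\<open>\<Gamma>\<close> acts on the quotient field through its action on \<open>\<sigma>\<^sup>*\<close>-polynomials, so
  \<open>\<gamma> \<eta>\<^sub>i\<close> is the image of the indeterminate \<open>\<gamma> y\<^sub>i\<close>.\<close>

definition ball_field :: "('k::field_char_0 \<Rightarrow> 'k) \<Rightarrow> ('k \<Rightarrow> 'k) \<Rightarrow>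
    ('k, 'n) sigma_poly set \<Rightarrow> nat \<Rightarrow>
    (('k, 'n) sigma_poly set \<times> ('k, 'n) sigma_poly set) set set" where
  "ball_field \<alpha>1 \<alpha>2 S r =
     generate_field (quotient_field (system_ring \<alpha>1 \<alpha>2 S))
       (range (\<lambda>c. system_map \<alpha>1 \<alpha>2 S (Const c)) \<union>
        {system_map \<alpha>1 \<alpha>2 S (Var (\<gamma>, i)) |\<gamma> i. \<gamma> \<in> shift_ball r})"

text \<open>Relational, as the polynomial exists only for prime systems; for these it is unique.\<close>

definition has_dimension_polynomial :: "('k::field_char_0 \<Rightarrow> 'k) \<Rightarrow> ('k \<Rightarrow> 'k) \<Rightarrow>
    ('k, 'n::finite) sigma_poly set \<Rightarrow> rat poly \<Rightarrow> bool" where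
  "has_dimension_polynomial \<alpha>1 \<alpha>2 S \<psi> \<longleftrightarrow>
     prime_system \<alpha>1 \<alpha>2 S \<and>
     (\<forall>\<^sub>F r in sequentially. \<exists>d.
        has_trdeg (quotient_field (system_ring \<alpha>1 \<alpha>2 S))
          (\<lambda>c. system_map \<alpha>1 \<alpha>2 S (Const c)) (ball_field \<alpha>1 \<alpha>2 S r) d \<and>
        poly \<psi> (of_nat r) = of_nat d)"

definition eventually_less :: "rat poly \<Rightarrow> rat poly \<Rightarrow> bool" where
  "eventually_less f g \<longleftrightarrow> (\<forall>\<^sub>F r in sequentially. poly f (of_nat r) < poly g (of_nat r))"

definition higher_strength :: "('k::field_char_0 \<Rightarrow> 'k) \<Rightarrow> ('k \<Rightarrow> 'k) \<Rightarrow>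
    ('k, 'n::finite) sigma_poly set \<Rightarrow> ('k, 'n) sigma_poly set \<Rightarrow> bool" where
  "higher_strength \<alpha>1 \<alpha>2 S T \<longleftrightarrow>
     (\<exists>\<phi> \<psi>. has_dimension_polynomial \<alpha>1 \<alpha>2 S \<phi> \<and> has_dimension_polynomial \<alpha>1 \<alpha>2 T \<psi> \<and>
            eventually_less \<phi> \<psi>)"


section \<open>Difference schemes for the diffusion equation\<close>

text \<open>One \<open>\<sigma>\<^sup>*\<close>-indeterminate \<open>y\<close>: \<open>'n\<close> is \<^typ>\<open>unit\<close>, and \<open>Y i j\<close> is \<open>\<alpha>1\<^sup>i \<alpha>2\<^sup>j y\<close>.\<close>

abbreviation Y :: "int \<Rightarrow> int \<Rightarrow> ('k::field_char_0, unit) sigma_poly" where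
  "Y i j \<equiv> Var ((i, j), ())"

definition forward_scheme :: "'k::field_char_0 \<Rightarrow> ('k, unit) sigma_poly" where
  "forward_scheme a =
     Const a * Y 2 0 - Const (2 * a) * Y 1 0 - Y 0 1 + Const (a + 1) * Y 0 0"

definition symmetric_scheme :: "'k::field_char_0 \<Rightarrow> ('k, unit) sigma_poly" where
  "symmetric_scheme a =
     Const a * Y 1 0 + Const a * Y (-1) 0 - Y 0 1 + Y 0 (-1) - Const (2 * a) * Y 0 0"

text \<open>The Crank-Nicholson scheme with unit steps: the forward difference quotient in \<open>t\<close> equals
  \<open>a\<close> times the mean of the central second differences in \<open>x\<close> at the times \<open>t\<close> and \<open>t + 1\<close>.\<close>

definition crank_nicholson_scheme :: "'k::field_char_0 \<Rightarrow> ('k, unit) sigma_poly" where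
  "crank_nicholson_scheme a =
     (Y 0 1 - Y 0 0) -
     Const (a / 2) * ((Y 1 1 - 2 * Y 0 1 + Y (-1) 1) + (Y 1 0 - 2 * Y 0 0 + Y (-1) 0))"

text \<open>The last term of the form is a parameter \<open>T\<close>: it is \<open>a\<^sub>5\<close> as
  printed in the source, and \<open>a\<^sub>5 y\<close> for the scheme above.\<close>

definition crank_nicholson_form :: "'k::field_char_0 \<Rightarrow> 'k \<Rightarrow> 'k \<Rightarrow> 'k \<Rightarrow>
    ('k, unit) sigma_poly \<Rightarrow> ('k, unit) sigma_poly" where
  "crank_nicholson_form a1 a2 a3 a4 T =
     Y 1 1 + Const a1 * Y (-1) 1 + Const a2 * Y 1 0 + Const a3 * Y 0 1 + Const a4 * Y (-1) 0 + T"

end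

theory Submission
  imports Defs "HOL-Library.Product_Lexorder"
begin

text \<open>
  Each scheme is a single linear equation, so the system consists of the shifts of one affine
  linear form \<open>A\<close>. The idea is to solve every shift \<open>\<gamma> A = 0\<close> for one well-chosen term: a
  \<^emph>\<open>corner\<close> of the support of \<open>A\<close> whose order after the shift by \<open>\<gamma>\<close> is maximal. If different
  \<open>\<gamma>\<close> lead to different shifted corners, and if the elimination is well founded, then the system is
  triangular. The points of \<open>\<int> \<times> \<int>\<close> that are the shifted corner of no \<open>\<gamma>\<close> carry the free initial
  data, and every other indeterminate becomes an affine combination of free ones.

  For triangular systems everything follows from the normal form, the substitution of these
  combinations for the eliminated indeterminates. It is an endomorphism of the polynomial ring whose
  kernel is exactly the ideal of the system (\<open>in_I_iff\<close>). The ideal is therefore prime, and the free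
  indeterminates remain algebraically independent in the quotient field. Because the corner has
  maximal order within its shift, eliminating inside a ball \<open>\<Gamma>(r)\<close> never leaves the ball. So
  the free points inside the ball give a transcendence basis (\<open>trdeg_closed_set\<close>), and the dimension
  polynomial counts them (\<open>dimension_polynomial_affine_form\<close>).

  What remains is to choose the corners, by the half planes or quadrants in which \<open>\<gamma>\<close> lies. For
  the forward scheme the free points are two columns and half of a row, with
  \<open>(2 r + 1) + (2 r - 1) + r = 5 r\<close> points in the ball; for the symmetric scheme they are two rows,
  with \<open>4 r\<close> points; for the Crank-Nicholson scheme they are two columns and one row, with
  \<open>6 r - 1\<close> points.
\<close>

section \<open>Evaluation homomorphisms of polynomial rings\<close>

definition monom_eval :: "('v \<Rightarrow> 'r::comm_ring_1) \<Rightarrow> ('v \<Rightarrow>\<^sub>0 nat) \<Rightarrow> 'r" where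
  "monom_eval x m = (\<Prod>v\<in>Poly_Mapping.keys m. x v ^ Poly_Mapping.lookup m v)"

text \<open>The extension of \<open>h\<close> to polynomials that sends the indeterminate \<open>v\<close> to \<open>x v\<close>. Shifts of
  \<open>\<sigma>\<^sup>*\<close>-polynomials, substitutions and renamings of indeterminates are all of this form.\<close>

definition poly_eval :: "('k::comm_ring_1 \<Rightarrow> 'r::comm_ring_1) \<Rightarrow> ('v \<Rightarrow> 'r) \<Rightarrow> ('k, 'v) mpoly \<Rightarrow> 'r" where
  "poly_eval h x p = (\<Sum>m\<in>Poly_Mapping.keys p. h (Poly_Mapping.lookup p m) * monom_eval x m)"

lemma monom_eval_superset:
  assumes "finite A" "Poly_Mapping.keys m \<subseteq> A"
  shows "monom_eval x m = (\<Prod>v\<in>A. x v ^ Poly_Mapping.lookup m v)"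
  unfolding monom_eval_def
  by (rule prod.mono_neutral_left) (use assms in \<open>auto simp: in_keys_iff\<close>)

lemma monom_eval_add: "monom_eval x (m + n) = monom_eval x m * monom_eval x n"
proof -
  let ?A = "Poly_Mapping.keys m \<union> Poly_Mapping.keys n"
  have "monom_eval x (m + n) = (\<Prod>v\<in>?A. x v ^ Poly_Mapping.lookup (m + n) v)"
    by (rule monom_eval_superset) (auto dest: set_mp[OF Poly_Mapping.keys_add])
  also have "\<dots> = monom_eval x m * monom_eval x n"
    by (simp add: lookup_add power_add prod.distrib monom_eval_superset[of ?A])
  finally show ?thesis .
qed

lemma monom_eval_zero [simp]: "monom_eval x 0 = 1"
  by (simp add: monom_eval_def)

lemma monom_eval_single [simp]: "monom_eval x (Poly_Mapping.single v n) = x v ^ n"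
  by (simp add: monom_eval_def)

lemma poly_mapping_sum_singles:
  fixes p :: "'a \<Rightarrow>\<^sub>0 'b::comm_monoid_add"
  shows "p = (\<Sum>m\<in>Poly_Mapping.keys p. Poly_Mapping.single m (Poly_Mapping.lookup p m))"
  by (rule poly_mapping_eqI)
     (simp add: lookup_sum lookup_single when_def in_keys_iff)

lemma Const_mult_Const: "Const a * Const b = Const (a * b)"
  by (simp add: Const_def mult_single)

lemma Const_add: "Const (a + b) = Const a + Const b"
  by (simp add: Const_def single_add)

lemma Const_diff: "Const (a - b) = Const a - Const b"
  by (simp add: Const_def single_diff)

lemma Const_uminus: "Const (- a) = - Const a"
  by (simp add: Const_def single_uminus)

lemma Const_0 [simp]: "Const 0 = 0"
  by (simp add: Const_def)

lemma Const_1 [simp]: "Const 1 = 1"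
  by (simp add: Const_def)

locale coefficient_hom =
  fixes h :: "'k::comm_ring_1 \<Rightarrow> 'r::comm_ring_1"
  assumes hom_add: "h (a + b) = h a + h b"
    and hom_mult: "h (a * b) = h a * h b"
    and hom_one: "h 1 = 1"
begin

lemma hom_zero: "h 0 = 0"
  using hom_add[of 0 0] by simp

lemma poly_eval_superset:
  assumes "finite A" "Poly_Mapping.keys p \<subseteq> A"
  shows "poly_eval h x p = (\<Sum>m\<in>A. h (Poly_Mapping.lookup p m) * monom_eval x m)"
  unfolding poly_eval_def
  by (rule sum.mono_neutral_left) (use assms in \<open>auto simp: in_keys_iff hom_zero\<close>)

lemma poly_eval_add: "poly_eval h x (p + q) = poly_eval h x p + poly_eval h x q"
proof -
  let ?A = "Poly_Mapping.keys p \<union> Poly_Mapping.keys q"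
  have "poly_eval h x (p + q) = (\<Sum>m\<in>?A. h (Poly_Mapping.lookup (p + q) m) * monom_eval x m)"
    by (rule poly_eval_superset) (auto dest: set_mp[OF Poly_Mapping.keys_add])
  also have "\<dots> = poly_eval h x p + poly_eval h x q"
    by (simp add: lookup_add hom_add sum.distrib ring_distribs poly_eval_superset[of ?A])
  finally show ?thesis .
qed

lemma poly_eval_single: "poly_eval h x (Poly_Mapping.single m c) = h c * monom_eval x m"
  by (simp add: poly_eval_def hom_zero)

lemma poly_eval_zero [simp]: "poly_eval h x 0 = 0"
  by (simp add: poly_eval_def)

lemma poly_eval_sum: "poly_eval h x (sum f A) = (\<Sum>i\<in>A. poly_eval h x (f i))"
  by (induction A rule: infinite_finite_induct) (auto simp: poly_eval_add)

lemma poly_eval_mult: "poly_eval h x (p * q) = poly_eval h x p * poly_eval h x q"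
proof -
  let ?t = "\<lambda>p m. Poly_Mapping.single m (Poly_Mapping.lookup p m)"
  have "poly_eval h x (p * q) =
      poly_eval h x ((\<Sum>m\<in>Poly_Mapping.keys p. ?t p m) * (\<Sum>n\<in>Poly_Mapping.keys q. ?t q n))"
    by (simp flip: poly_mapping_sum_singles)
  also have "\<dots> = (\<Sum>m\<in>Poly_Mapping.keys p. \<Sum>n\<in>Poly_Mapping.keys q.
      (h (Poly_Mapping.lookup p m) * monom_eval x m) * (h (Poly_Mapping.lookup q n) * monom_eval x n))"
    by (simp add: sum_product poly_eval_sum mult_single poly_eval_single hom_mult monom_eval_add
        mult_ac)
  also have "\<dots> = poly_eval h x p * poly_eval h x q"
    by (simp add: poly_eval_def sum_product)
  finally show ?thesis .
qed

lemma poly_eval_Const [simp]: "poly_eval h x (Const c) = h c"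
  by (simp add: Const_def poly_eval_single)

lemma poly_eval_Var [simp]: "poly_eval h x (Var v) = x v"
  by (simp add: Var_def poly_eval_single hom_one)

lemma poly_eval_one [simp]: "poly_eval h x 1 = 1"
  using poly_eval_Const[of x 1] by (simp add: hom_one)

lemma poly_eval_uminus: "poly_eval h x (- p) = - poly_eval h x p"
  using poly_eval_add[of x p "- p"] by (simp add: eq_neg_iff_add_eq_0 add.commute)

lemma poly_eval_diff: "poly_eval h x (p - q) = poly_eval h x p - poly_eval h x q"
  using poly_eval_add[of x p "- q"] by (simp add: poly_eval_uminus)

lemma poly_eval_power: "poly_eval h x (p ^ n) = poly_eval h x p ^ n"
  by (induction n) (simp_all add: poly_eval_mult)

lemma poly_eval_prod: "poly_eval h x (prod f A) = (\<Prod>i\<in>A. poly_eval h x (f i))"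
  by (induction A rule: infinite_finite_induct) (auto simp: poly_eval_mult)

lemmas poly_eval_simps =
  poly_eval_add poly_eval_mult poly_eval_diff poly_eval_uminus poly_eval_sum
  poly_eval_power poly_eval_prod

text \<open>Functoriality of substitution; it serves to undo a renaming of indeterminates.\<close>

lemma poly_eval_subst:
  "poly_eval h x (poly_eval Const g p) = poly_eval h (\<lambda>v. poly_eval h x (g v)) p"
  unfolding poly_eval_def[of Const] monom_eval_def
  by (simp add: poly_eval_simps) (simp add: poly_eval_def monom_eval_def)

end

interpretation Const: coefficient_hom Const
  by standard (simp_all add: Const_add Const_mult_Const)

definition indets :: "('k::zero, 'v) mpoly \<Rightarrow> 'v set" where
  "indets p = (\<Union>m\<in>Poly_Mapping.keys p. Poly_Mapping.keys m)"

lemma poly_eval_cong: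
  assumes "\<And>v. v \<in> indets p \<Longrightarrow> x v = y v"
  shows "poly_eval h x p = poly_eval h y p"
  unfolding poly_eval_def monom_eval_def
  by (intro sum.cong prod.cong refl arg_cong2[of _ _ _ _ "(*)"] arg_cong2[of _ _ _ _ "(^)"] assms)
     (auto simp: indets_def)

lemma monom_eval_Var: "monom_eval Var m = Poly_Mapping.single m (1::'k::comm_ring_1)"
proof -
  have pw: "Var v ^ n = Poly_Mapping.single (Poly_Mapping.single v n) (1::'k)" for v :: 'v and n
    by (induction n) (simp_all add: Var_def mult_single flip: single_add)
  have *: "(\<Prod>v\<in>A. Poly_Mapping.single (f v) (1::'k)) = Poly_Mapping.single (sum f A) 1"
    for A :: "'v set" and f :: "'v \<Rightarrow> 'v \<Rightarrow>\<^sub>0 nat"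
    by (induction A rule: infinite_finite_induct) (simp_all add: mult_single)
  then show ?thesis
    unfolding monom_eval_def pw * by (simp flip: poly_mapping_sum_singles)
qed

lemma poly_eval_Const_Var: "poly_eval Const Var p = p"
  by (subst (2) poly_mapping_sum_singles)
     (simp add: poly_eval_def monom_eval_Var Const_def mult_single)

lemma poly_eval_Const_fixed:
  assumes "\<And>v. v \<in> indets p \<Longrightarrow> x v = Var v"
  shows "poly_eval Const x p = p"
  using poly_eval_cong[of p x Var Const] assms by (simp add: poly_eval_Const_Var)

lemma indets_add: "indets (p + q) \<subseteq> indets p \<union> indets q"
  using Poly_Mapping.keys_add[of p q] by (auto simp: indets_def)

lemma Var_eq_iff: "Var v = (Var w :: ('k::comm_ring_1, 'v) mpoly) \<longleftrightarrow> v = w"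
proof
  assume "Var v = (Var w :: ('k, 'v) mpoly)"
  then have "Poly_Mapping.keys (Var v :: ('k, 'v) mpoly) = Poly_Mapping.keys (Var w :: ('k, 'v) mpoly)"
    by (rule arg_cong)
  then have "Poly_Mapping.keys (Poly_Mapping.single v (1::nat)) = Poly_Mapping.keys (Poly_Mapping.single w (1::nat))"
    by (simp add: Var_def)
  then show "v = w" by simp
qed simp

lemma indets_uminus [simp]: "indets (- p) = indets p"
proof -
  have "Poly_Mapping.keys (- p) = Poly_Mapping.keys p" by (auto simp: in_keys_iff)
  then show ?thesis by (simp add: indets_def)
qed

lemma indets_mult: "indets (p * q) \<subseteq> indets p \<union> indets q"
proof
  fix v assume "v \<in> indets (p * q)"
  then obtain m where m: "m \<in> Poly_Mapping.keys (p * q)" "v \<in> Poly_Mapping.keys m"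
    by (auto simp: indets_def)
  then obtain a b where "m = a + b" "a \<in> Poly_Mapping.keys p" "b \<in> Poly_Mapping.keys q"
    using keys_mult[of p q] by blast
  with m show "v \<in> indets p \<union> indets q"
    using Poly_Mapping.keys_add[of a b] by (auto simp: indets_def)
qed

lemma indets_Const [simp]: "indets (Const c) = {}"
  by (auto simp: indets_def Const_def)

lemma indets_one [simp]: "indets 1 = {}"
  and indets_zero [simp]: "indets 0 = {}"
  by (simp_all add: indets_def)

lemma indets_Var: "indets (Var v) \<subseteq> {v}"
  by (auto simp: indets_def Var_def)

lemma indets_sum: "indets (sum f A) \<subseteq> (\<Union>i\<in>A. indets (f i))"
proof (induction A rule: infinite_finite_induct)
  case (insert a A)
  then show ?case using indets_add[of "f a" "sum f A"] by auto
qed simp_all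

text \<open>A value of a polynomial lies in every subring that contains the constants and the arguments.
  The subring can be the polynomials in given indeterminates, which bounds the indeterminates of a
  substitution, or the preimage of a subfield, which places residues in a generated field.\<close>

lemma poly_eval_closed:
  fixes T :: "'r::comm_ring_1 set"
  assumes one: "1 \<in> T" and zero: "0 \<in> T"
    and add: "\<And>a b. a \<in> T \<Longrightarrow> b \<in> T \<Longrightarrow> a + b \<in> T"
    and mult: "\<And>a b. a \<in> T \<Longrightarrow> b \<in> T \<Longrightarrow> a * b \<in> T"
    and h: "\<And>c. h c \<in> T" and x: "\<And>v. v \<in> indets p \<Longrightarrow> x v \<in> T"
  shows "poly_eval h x p \<in> T"
proof -
  have sum: "sum f A \<in> T" if "\<And>i. i \<in> A \<Longrightarrow> f i \<in> T" for f :: "('b \<Rightarrow>\<^sub>0 nat) \<Rightarrow> 'r" and A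
    using that by (induction A rule: infinite_finite_induct) (auto intro: zero add)
  have prod: "prod f A \<in> T" if "\<And>i. i \<in> A \<Longrightarrow> f i \<in> T" for f :: "'b \<Rightarrow> 'r" and A
    using that by (induction A rule: infinite_finite_induct) (auto intro: one mult)
  have power: "a ^ n \<in> T" if "a \<in> T" for a n
    using that by (induction n) (auto intro: one mult)
  show ?thesis
    unfolding poly_eval_def monom_eval_def
    by (intro sum mult h prod power x) (auto simp: indets_def)
qed

lemma indets_poly_eval:
  fixes g :: "'v \<Rightarrow> ('k::comm_ring_1, 'w) mpoly"
  assumes "\<And>v. v \<in> indets p \<Longrightarrow> indets (g v) \<subseteq> W"
  shows "indets (poly_eval Const g p) \<subseteq> W"
proof -
  have *: "indets 1 \<subseteq> W" "indets 0 \<subseteq> W" "indets (Const c) \<subseteq> W" for c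
    by simp_all
  have "poly_eval Const g p \<in> {q. indets q \<subseteq> W}"
    by (rule poly_eval_closed; unfold mem_Collect_eq)
       (fact * assms order_trans[OF indets_add Un_least] order_trans[OF indets_mult Un_least])+
  then show ?thesis by simp
qed

section \<open>The quotient field of a domain\<close>

text \<open>The operations of the quotient field are unions over all representatives. They are well
  defined as soon as all members of the union coincide.\<close>

lemma UN_pairs_constant:
  assumes "p \<in> U" "q \<in> V"
    and "\<And>a b c d. (a, b) \<in> U \<Longrightarrow> (c, d) \<in> V \<Longrightarrow> G a b c d = w"
  shows "(\<Union>(a, b)\<in>U. \<Union>(c, d)\<in>V. G a b c d) = w"
proof -
  have "(\<Union>(c, d)\<in>V. G a b c d) = w" if "(a, b) \<in> U" for a b
    using assms that by (auto simp: split_beta intro!: UN_constant_eq)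
  then show ?thesis
    using assms by (auto simp: split_beta intro!: UN_constant_eq)
qed

context domain
begin

lemma fraction_self: "a \<in> carrier R \<Longrightarrow> b \<in> carrier R - {\<zero>} \<Longrightarrow> (a, b) \<in> fraction R a b"
  by (simp add: fraction_def)

lemma fraction_eq_iff:
  assumes "a \<in> carrier R" "b \<in> carrier R - {\<zero>}" "c \<in> carrier R" "d \<in> carrier R - {\<zero>}"
  shows "fraction R a b = fraction R c d \<longleftrightarrow> a \<otimes> d = c \<otimes> b"
proof
  assume "fraction R a b = fraction R c d"
  then have "(c, d) \<in> fraction R a b" using fraction_self[OF assms(3,4)] by simp
  then show "a \<otimes> d = c \<otimes> b" by (simp add: fraction_def)
next
  \<comment> \<open>equality of fractions is transitive, because the middle denominator \<open>d\<close> can be cancelled\<close>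
  have trans: "a \<otimes> f = e \<otimes> b"
    if "a \<in> carrier R" "b \<in> carrier R" "c \<in> carrier R" "d \<in> carrier R - {\<zero>}"
       "f \<in> carrier R" "e \<in> carrier R" "a \<otimes> d = c \<otimes> b" "c \<otimes> f = e \<otimes> d" for a b c d f e
  proof -
    have "(a \<otimes> f) \<otimes> d = (a \<otimes> d) \<otimes> f" using that(1-6) by (simp add: m_ac)
    also have "\<dots> = (c \<otimes> f) \<otimes> b" using that(1-6) by (simp add: that(7) m_ac)
    also have "\<dots> = (e \<otimes> b) \<otimes> d" using that(1-6) by (simp add: that(8) m_ac)
    finally show ?thesis using that(1-6) m_rcancel[of d "a \<otimes> f" "e \<otimes> b"] by simp
  qed
  assume eq: "a \<otimes> d = c \<otimes> b"
  have "(e, f) \<in> fraction R a b \<longleftrightarrow> (e, f) \<in> fraction R c d" for e f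
    unfolding fraction_def mem_Collect_eq case_prod_conv
    using trans[of a b c d f e, OF assms(1) _ assms(3,4) _ _ eq]
      trans[of c d a b f e, OF assms(3) _ assms(1,2) _ _ eq[symmetric]] assms(2,4) by blast
  then show "fraction R a b = fraction R c d" by auto
qed

lemma nonzero_mult:
  "b \<in> carrier R - {\<zero>} \<Longrightarrow> d \<in> carrier R - {\<zero>} \<Longrightarrow> b \<otimes> d \<in> carrier R - {\<zero>}"
  using integral by auto

lemma fraction_memD:
  assumes "(c, d) \<in> fraction R a b"
  shows "c \<in> carrier R" "d \<in> carrier R" "d \<noteq> \<zero>" "a \<otimes> d = c \<otimes> b"
  using assms by (auto simp: fraction_def)

lemma fraction_mult:
  assumes "a \<in> carrier R" "b \<in> carrier R - {\<zero>}" "c \<in> carrier R" "d \<in> carrier R - {\<zero>}"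
  shows "fraction R a b \<otimes>\<^bsub>quotient_field R\<^esub> fraction R c d = fraction R (a \<otimes> c) (b \<otimes> d)"
proof -
  have "fraction R (a' \<otimes> c') (b' \<otimes> d') = fraction R (a \<otimes> c) (b \<otimes> d)"
    if "(a', b') \<in> fraction R a b" "(c', d') \<in> fraction R c d" for a' b' c' d'
  proof -
    note cl = fraction_memD[OF that(1)] fraction_memD[OF that(2)]
    have b: "b \<in> carrier R" and d: "d \<in> carrier R" using assms by auto
    have "a' \<otimes> c' \<otimes> (b \<otimes> d) = (a' \<otimes> b) \<otimes> (c' \<otimes> d)"
      using cl(1-3,5-7) assms(1,3) b d by (simp add: m_ac)
    also have "\<dots> = (a \<otimes> b') \<otimes> (c \<otimes> d')" by (simp add: cl)
    also have "\<dots> = a \<otimes> c \<otimes> (b' \<otimes> d')"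
      using cl(1-3,5-7) assms(1,3) b d by (simp add: m_ac)
    finally show ?thesis
      by (subst fraction_eq_iff)
         (use cl(1-3,5-7) assms(1,3) b d in \<open>auto intro!: nonzero_mult assms(2,4) simp del: Diff_iff\<close>)
  qed
  then show ?thesis
    unfolding quotient_field_def monoid.simps ring.simps
    by (rule UN_pairs_constant[OF fraction_self[OF assms(1,2)] fraction_self[OF assms(3,4)]])
qed

lemma fraction_add:
  assumes "a \<in> carrier R" "b \<in> carrier R - {\<zero>}" "c \<in> carrier R" "d \<in> carrier R - {\<zero>}"
  shows "fraction R a b \<oplus>\<^bsub>quotient_field R\<^esub> fraction R c d =
    fraction R (a \<otimes> d \<oplus> c \<otimes> b) (b \<otimes> d)"
proof -
  have "fraction R (a' \<otimes> d' \<oplus> c' \<otimes> b') (b' \<otimes> d') = fraction R (a \<otimes> d \<oplus> c \<otimes> b) (b \<otimes> d)"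
    if "(a', b') \<in> fraction R a b" "(c', d') \<in> fraction R c d" for a' b' c' d'
  proof -
    note cl = fraction_memD[OF that(1)] fraction_memD[OF that(2)]
    have b: "b \<in> carrier R" and d: "d \<in> carrier R" using assms by auto
    have "(a' \<otimes> d' \<oplus> c' \<otimes> b') \<otimes> (b \<otimes> d) = (a' \<otimes> b) \<otimes> (d \<otimes> d') \<oplus> (c' \<otimes> d) \<otimes> (b \<otimes> b')"
      using cl(1-3,5-7) assms(1,3) b d by (simp add: m_ac l_distr r_distr)
    also have "\<dots> = (a \<otimes> b') \<otimes> (d \<otimes> d') \<oplus> (c \<otimes> d') \<otimes> (b \<otimes> b')" by (simp add: cl)
    also have "\<dots> = (a \<otimes> d \<oplus> c \<otimes> b) \<otimes> (b' \<otimes> d')" 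
      using cl(1-3,5-7) assms(1,3) b d by (simp add: m_ac l_distr r_distr)
    finally show ?thesis
      by (subst fraction_eq_iff)
         (use cl(1-3,5-7) assms(1,3) b d in \<open>auto intro!: nonzero_mult assms(2,4) simp del: Diff_iff\<close>)
  qed
  then show ?thesis
    unfolding quotient_field_def monoid.simps ring.simps
    by (rule UN_pairs_constant[OF fraction_self[OF assms(1,2)] fraction_self[OF assms(3,4)]])
qed

lemma quotient_field_carrierE:
  assumes "x \<in> carrier (quotient_field R)"
  obtains a b where "x = fraction R a b" "a \<in> carrier R" "b \<in> carrier R" "b \<noteq> \<zero>"
  using assms by (auto simp: quotient_field_def)

lemma fraction_closed:
  "a \<in> carrier R \<Longrightarrow> b \<in> carrier R - {\<zero>} \<Longrightarrow> fraction R a b \<in> carrier (quotient_field R)"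
  by (auto simp: quotient_field_def)

lemma quotient_field_zero: "\<zero>\<^bsub>quotient_field R\<^esub> = fraction R \<zero> \<one>"
  and quotient_field_one: "\<one>\<^bsub>quotient_field R\<^esub> = fraction R \<one> \<one>"
  by (simp_all add: quotient_field_def)

lemma quotient_field_is_cring: "cring (quotient_field R)"
proof (rule cringI)
  let ?Q = "quotient_field R"
  note simps = fraction_add fraction_mult quotient_field_zero quotient_field_one
  show "abelian_group ?Q"
  proof (rule abelian_groupI)
    fix x y assume "x \<in> carrier ?Q" "y \<in> carrier ?Q"
    then show "x \<oplus>\<^bsub>?Q\<^esub> y \<in> carrier ?Q" "x \<oplus>\<^bsub>?Q\<^esub> y = y \<oplus>\<^bsub>?Q\<^esub> x"
      by (auto elim!: quotient_field_carrierE simp: simps a_ac m_ac integral_iff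
          intro!: fraction_closed)
  next
    fix x y z assume "x \<in> carrier ?Q" "y \<in> carrier ?Q" "z \<in> carrier ?Q"
    then show "x \<oplus>\<^bsub>?Q\<^esub> y \<oplus>\<^bsub>?Q\<^esub> z = x \<oplus>\<^bsub>?Q\<^esub> (y \<oplus>\<^bsub>?Q\<^esub> z)"
      by (auto elim!: quotient_field_carrierE simp: simps a_ac m_ac l_distr r_distr integral_iff)
  next
    show "\<zero>\<^bsub>?Q\<^esub> \<in> carrier ?Q" by (simp add: simps fraction_closed)
  next
    fix x assume "x \<in> carrier ?Q"
    then obtain a b where x: "x = fraction R a b" "a \<in> carrier R" "b \<in> carrier R - {\<zero>}"
      by (auto elim: quotient_field_carrierE)
    then show "\<zero>\<^bsub>?Q\<^esub> \<oplus>\<^bsub>?Q\<^esub> x = x" by (auto simp: simps)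
    have "fraction R (\<ominus> a) b \<oplus>\<^bsub>?Q\<^esub> x = \<zero>\<^bsub>?Q\<^esub>"
      using x by (simp add: simps fraction_eq_iff l_minus l_neg integral_iff)
    then show "\<exists>y\<in>carrier ?Q. y \<oplus>\<^bsub>?Q\<^esub> x = \<zero>\<^bsub>?Q\<^esub>"
      using x by (blast intro: fraction_closed)
  qed
  show "Group.comm_monoid ?Q"
  proof (rule comm_monoidI)
    fix x y assume "x \<in> carrier ?Q" "y \<in> carrier ?Q"
    then show "x \<otimes>\<^bsub>?Q\<^esub> y \<in> carrier ?Q" "x \<otimes>\<^bsub>?Q\<^esub> y = y \<otimes>\<^bsub>?Q\<^esub> x"
      by (auto elim!: quotient_field_carrierE simp: simps m_ac integral_iff
          intro!: fraction_closed)
  next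
    fix x y z assume "x \<in> carrier ?Q" "y \<in> carrier ?Q" "z \<in> carrier ?Q"
    then show "x \<otimes>\<^bsub>?Q\<^esub> y \<otimes>\<^bsub>?Q\<^esub> z = x \<otimes>\<^bsub>?Q\<^esub> (y \<otimes>\<^bsub>?Q\<^esub> z)"
      by (auto elim!: quotient_field_carrierE simp: simps m_ac integral_iff)
  next
    show "\<one>\<^bsub>?Q\<^esub> \<in> carrier ?Q" by (simp add: simps fraction_closed)
  next
    fix x assume "x \<in> carrier ?Q"
    then show "\<one>\<^bsub>?Q\<^esub> \<otimes>\<^bsub>?Q\<^esub> x = x" by (auto elim!: quotient_field_carrierE simp: simps)
  qed
  show "(x \<oplus>\<^bsub>?Q\<^esub> y) \<otimes>\<^bsub>?Q\<^esub> z = x \<otimes>\<^bsub>?Q\<^esub> z \<oplus>\<^bsub>?Q\<^esub> y \<otimes>\<^bsub>?Q\<^esub> z"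
    if xyz: "x \<in> carrier ?Q" "y \<in> carrier ?Q" "z \<in> carrier ?Q" for x y z
  proof -
    obtain a b c d e f where x: "x = fraction R a b" and y: "y = fraction R c d"
      and z: "z = fraction R e f"
      and cl: "a \<in> carrier R" "b \<in> carrier R" "c \<in> carrier R" "d \<in> carrier R"
        "e \<in> carrier R" "f \<in> carrier R" "b \<noteq> \<zero>" "d \<noteq> \<zero>" "f \<noteq> \<zero>"
      using xyz by (elim quotient_field_carrierE) auto
    then have "(x \<oplus>\<^bsub>?Q\<^esub> y) \<otimes>\<^bsub>?Q\<^esub> z = fraction R ((a \<otimes> d \<oplus> c \<otimes> b) \<otimes> e) (b \<otimes> d \<otimes> f)"
      by (simp add: simps integral_iff)
    also have "\<dots> = fraction R (a \<otimes> e \<otimes> (d \<otimes> f) \<oplus> c \<otimes> e \<otimes> (b \<otimes> f)) (b \<otimes> f \<otimes> (d \<otimes> f))"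
      using cl by (subst fraction_eq_iff) (simp_all add: m_ac l_distr r_distr integral_iff)
    also have "\<dots> = x \<otimes>\<^bsub>?Q\<^esub> z \<oplus>\<^bsub>?Q\<^esub> y \<otimes>\<^bsub>?Q\<^esub> z"
      using cl by (simp add: x y z simps integral_iff)
    finally show ?thesis .
  qed
qed

lemma quotient_field_is_field: "field (quotient_field R)"
proof (rule cring.cring_fieldI2[OF quotient_field_is_cring])
  show "\<zero>\<^bsub>quotient_field R\<^esub> \<noteq> \<one>\<^bsub>quotient_field R\<^esub>"
    by (simp add: quotient_field_zero quotient_field_one fraction_eq_iff)
next
  fix x assume "x \<in> carrier (quotient_field R)" and nz: "x \<noteq> \<zero>\<^bsub>quotient_field R\<^esub>"
  from this(1) obtain a b
    where x: "x = fraction R a b" "a \<in> carrier R" "b \<in> carrier R - {\<zero>}"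
    by (auto elim: quotient_field_carrierE)
  then have a: "a \<in> carrier R - {\<zero>}"
    using nz by (auto simp: quotient_field_zero fraction_eq_iff)
  have "x \<otimes>\<^bsub>quotient_field R\<^esub> fraction R b a = \<one>\<^bsub>quotient_field R\<^esub>"
    using x a nonzero_mult[OF x(3) a]
    by (simp add: fraction_mult quotient_field_one fraction_eq_iff m_comm)
  then show "\<exists>y\<in>carrier (quotient_field R). x \<otimes>\<^bsub>quotient_field R\<^esub> y = \<one>\<^bsub>quotient_field R\<^esub>"
    using a x by (blast intro: fraction_closed)
qed

lemma to_quotient_field_hom: "to_quotient_field R \<in> ring_hom R (quotient_field R)"
  by (rule ring_hom_memI)
     (auto simp: to_quotient_field_def fraction_mult fraction_add quotient_field_one
       intro: fraction_closed)

lemma to_quotient_field_eq_iff: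
  "a \<in> carrier R \<Longrightarrow> b \<in> carrier R \<Longrightarrow>
    to_quotient_field R a = to_quotient_field R b \<longleftrightarrow> a = b"
  by (simp add: to_quotient_field_def fraction_eq_iff)

end

section \<open>Homomorphisms from type-class rings\<close>

text \<open>The polynomial ring is a type-class ring, its quotients are rings with a carrier. In this
  locale sums and products on the two sides are translated into each other.\<close>

locale type_ring_hom = cring L for L :: "('l, 'b) ring_scheme" (structure) +
  fixes \<pi> :: "'r::comm_ring_1 \<Rightarrow> 'l"
  assumes hom: "\<pi> \<in> ring_hom ring_of_type_algebra L"
begin

lemma pi_closed [simp]: "\<pi> x \<in> carrier L"
  and pi_add: "\<pi> (x + y) = \<pi> x \<oplus> \<pi> y"
  and pi_mult: "\<pi> (x * y) = \<pi> x \<otimes> \<pi> y"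
  and pi_one: "\<pi> 1 = \<one>"
  using ring_hom_closed[OF hom, of x] ring_hom_add[OF hom, of x y] ring_hom_mult[OF hom, of x y]
    ring_hom_one[OF hom]
  by (simp_all add: ring_of_type_algebra_def)

lemma pi_zero: "\<pi> 0 = \<zero>"
  using pi_add[of 0 0] by (simp add: add.l_cancel_one')

lemma pi_power: "\<pi> (x ^ n) = \<pi> x [^] n"
  by (induction n) (simp_all add: pi_one pi_mult m_comm)

lemma pi_sum: "finite A \<Longrightarrow> \<pi> (sum f A) = (\<Oplus>i\<in>A. \<pi> (f i))"
  by (induction A rule: finite_induct) (simp_all add: pi_zero pi_add)

lemma pi_prod: "finite A \<Longrightarrow> \<pi> (prod f A) = (\<Otimes>i\<in>A. \<pi> (f i))"
  by (induction A rule: finite_induct) (simp_all add: pi_one pi_mult)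

lemma pi_eq_iff: "\<pi> x = \<pi> y \<longleftrightarrow> \<pi> (x - y) = \<zero>"
proof -
  have "\<pi> x = \<pi> (x - y) \<oplus> \<pi> y" by (simp flip: pi_add)
  then show ?thesis by (simp add: add.r_cancel_one)
qed

text \<open>The arguments \<open>x\<close> need preimages only at the indeterminates that occur in \<open>p\<close>. This is what
  algebraic independence of a set \<open>B\<close> requires: there the indeterminates are all elements of
  \<open>L\<close>, and those that occur lie in \<open>B\<close>.\<close>

lemma mpoly_eval_hom:
  fixes h :: "'k::field \<Rightarrow> 'r"
  assumes "\<And>v. v \<in> indets p \<Longrightarrow> x v = \<pi> (y v)"
  shows "mpoly_eval L (\<lambda>c. \<pi> (h c)) x p = \<pi> (poly_eval h y p)"
proof -
  have "finprod L (\<lambda>v. x v [^] Poly_Mapping.lookup m v) (Poly_Mapping.keys m) = \<pi> (monom_eval y m)"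
    if "m \<in> Poly_Mapping.keys p" for m
    unfolding monom_eval_def pi_prod[OF finite_keys]
  proof (intro finprod_cong')
    fix v assume "v \<in> Poly_Mapping.keys m"
    with that have "x v = \<pi> (y v)" by (intro assms) (auto simp: indets_def)
    then show "x v [^] Poly_Mapping.lookup m v = \<pi> (y v ^ Poly_Mapping.lookup m v)"
      by (simp add: pi_power)
  qed auto
  then show ?thesis
    unfolding mpoly_eval_def poly_eval_def pi_sum[OF finite_keys]
    by (intro finsum_cong') (auto simp: pi_mult)
qed

lemma pi_poly_eval_cong:
  fixes h :: "'k::field \<Rightarrow> 'r"
  assumes "\<And>v. v \<in> indets p \<Longrightarrow> \<pi> (x v) = \<pi> (y v)"
  shows "\<pi> (poly_eval h x p) = \<pi> (poly_eval h y p)"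
  using mpoly_eval_hom[of p "\<lambda>v. \<pi> (x v)" x h] mpoly_eval_hom[of p "\<lambda>v. \<pi> (x v)" y h] assms
  by simp

end

lemma cring_type [simp]: "cring (ring_of_type_algebra :: 'r::comm_ring_1 ring)"
  by (rule cring_from_type_algebra)

lemma ring_of_type_algebra_simps [simp]:
  "carrier (ring_of_type_algebra :: 'r::comm_ring_1 ring) = UNIV"
  "a \<oplus>\<^bsub>ring_of_type_algebra\<^esub> b = (a + b :: 'r)"
  "a \<otimes>\<^bsub>ring_of_type_algebra\<^esub> b = (a * b :: 'r)"
  "\<zero>\<^bsub>ring_of_type_algebra\<^esub> = (0 :: 'r)"
  "\<one>\<^bsub>ring_of_type_algebra\<^esub> = (1 :: 'r)"
  by (simp_all add: ring_of_type_algebra_def)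

lemma ideal_type_ringI:
  fixes J :: "'r::comm_ring_1 set"
  assumes "0 \<in> J" and add: "\<And>a b. a \<in> J \<Longrightarrow> b \<in> J \<Longrightarrow> a + b \<in> J"
    and mult: "\<And>a x. a \<in> J \<Longrightarrow> x * a \<in> J"
  shows "ideal J ring_of_type_algebra"
proof -
  interpret R: cring "ring_of_type_algebra :: 'r ring" by simp
  show ?thesis
  proof (rule idealI)
    show "subgroup J (add_monoid ring_of_type_algebra)"
    proof (rule R.add.subgroupI)
      fix a assume "a \<in> J"
      moreover have "\<ominus>\<^bsub>ring_of_type_algebra\<^esub> a = - a"
        by (rule R.minus_equality) simp_all
      ultimately show "\<ominus>\<^bsub>ring_of_type_algebra\<^esub> a \<in> J"
        using mult[of a "- 1"] by simp
    qed (use assms in auto)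
  qed (use mult in \<open>auto simp: mult.commute intro: R.ring_axioms\<close>)
qed

lemma ideal_quotient_hom:
  fixes I :: "'r::comm_ring_1 set"
  assumes "ideal I ring_of_type_algebra"
  shows "type_ring_hom (ring_of_type_algebra Quot I) ((+>\<^bsub>ring_of_type_algebra\<^esub>) I)"
  using ideal.quotient_is_cring[OF assms cring_type] ideal.rcos_ring_hom[OF assms]
  by (simp add: type_ring_hom_def type_ring_hom_axioms_def)

lemma ideal_quotient_eq_zero_iff:
  fixes I :: "'r::comm_ring_1 set"
  assumes "ideal I ring_of_type_algebra"
  shows "I +>\<^bsub>ring_of_type_algebra\<^esub> x = \<zero>\<^bsub>ring_of_type_algebra Quot I\<^esub> \<longleftrightarrow> x \<in> I"
proof -
  interpret ideal I "ring_of_type_algebra :: 'r ring" by fact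
  show ?thesis
    using a_rcos_zero[OF assms, of x] a_rcos_self[of x] by (auto simp: FactRing_def)
qed

section \<open>Triangular systems\<close>

text \<open>Equation \<open>g\<close> can be solved for the indeterminate \<open>lead g\<close> in terms of indeterminates of
  smaller rank, and no indeterminate is solved for twice. The order on \<open>'v\<close> makes the
  polynomial ring an integral domain.\<close>

locale triangular_system =
  fixes lead :: "'g \<Rightarrow> 'v::linorder"
    and lc :: "'g \<Rightarrow> 'k::field"
    and tail :: "'g \<Rightarrow> ('k, 'v) mpoly"
    and rank :: "'v \<Rightarrow> nat"
  assumes inj_lead: "inj lead"
    and lc_nonzero: "lc g \<noteq> 0"
    and rank_tail: "v \<in> indets (tail g) \<Longrightarrow> rank v < rank (lead g)"
begin

definition equation :: "'g \<Rightarrow> ('k, 'v) mpoly" where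
  "equation g = Const (lc g) * Var (lead g) + tail g"

abbreviation R :: "('k, 'v) mpoly ring" where
  "R \<equiv> ring_of_type_algebra"

definition I :: "('k, 'v) mpoly set" where
  "I = genideal R (range equation)"

definition free :: "'v set" where
  "free = - range lead"

lemma poly_eval_fundef_cong [fundef_cong]:
  assumes "h = h'" "p = q" "\<And>v. v \<in> indets q \<Longrightarrow> x v = y v"
  shows "poly_eval h x p = poly_eval h' y q"
  using assms poly_eval_cong by blast

text \<open>The normal form of an indeterminate: eliminate leading indeterminates until only free ones
  are left.\<close>

function nf :: "'v \<Rightarrow> ('k, 'v) mpoly" where
  "nf v = (if v \<in> range lead
     then Const (- inverse (lc (inv_into UNIV lead v))) * poly_eval Const nf (tail (inv_into UNIV lead v))
     else Var v)"
  by pat_completeness auto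
termination
  by (relation "measure rank") (use rank_tail inj_lead in auto)

declare nf.simps [simp del]

lemma nf_free: "v \<in> free \<Longrightarrow> nf v = Var v"
  by (simp add: nf.simps free_def)

lemma nf_lead: "nf (lead g) = Const (- inverse (lc g)) * poly_eval Const nf (tail g)"
  using inj_lead by (simp add: nf.simps[of "lead g"])

lemma rank_induct [case_names free lead]:
  assumes "\<And>v. v \<in> free \<Longrightarrow> P v"
    and "\<And>g. (\<And>v. v \<in> indets (tail g) \<Longrightarrow> P v) \<Longrightarrow> P (lead g)"
  shows "P v"
proof (induction v rule: measure_induct_rule[of rank])
  case (less v)
  show ?case
  proof (cases "v \<in> free")
    case False
    then obtain g where "v = lead g" by (auto simp: free_def)
    then show ?thesis using less rank_tail assms(2) by blast
  qed (rule assms(1))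
qed

text \<open>If \<open>S\<close> contains, with a leading indeterminate, the whole equation, then the elimination does
  not leave \<open>S\<close>. For \<open>S = UNIV\<close> this says that normal forms contain free indeterminates only.\<close>

lemma indets_nf:
  assumes "\<And>g. lead g \<in> S \<Longrightarrow> indets (tail g) \<subseteq> S" and "v \<in> S"
  shows "indets (nf v) \<subseteq> S \<inter> free"
  using assms(2)
proof (induction v rule: rank_induct)
  case (free v)
  then show ?case using indets_Var[of v] by (auto simp: nf_free)
next
  case (lead g)
  then have "indets (poly_eval Const nf (tail g)) \<subseteq> S \<inter> free"
    using assms(1)[of g] by (intro indets_poly_eval) blast
  then show ?case
    using indets_mult[of "Const (- inverse (lc g))" "poly_eval Const nf (tail g)"]
    unfolding nf_lead by auto
qed

lemma Const_inverse: "c \<noteq> 0 \<Longrightarrow> Const c * (Const (inverse c) * p) = (p :: ('k, 'v) mpoly)"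
  by (simp add: Const_mult_Const flip: mult.assoc)

lemma nf_equation: "poly_eval Const nf (equation g) = 0"
  by (simp add: equation_def Const.poly_eval_simps nf_lead Const_uminus Const_inverse lc_nonzero)

lemma ideal_I: "ideal I R"
  unfolding I_def by (rule ring.genideal_ideal) (auto intro: ring_from_type_algebra)

lemma equation_in_I: "equation g \<in> I"
  unfolding I_def
  using ring.genideal_self[of R "range equation"] by (auto intro: ring_from_type_algebra)

lemma I_subset_kernel: "p \<in> I \<Longrightarrow> poly_eval Const nf p = 0"
proof -
  have "ideal {p. poly_eval Const nf p = 0} R"
    by (rule ideal_type_ringI) (auto simp: Const.poly_eval_simps)
  then have "I \<subseteq> {p. poly_eval Const nf p = 0}"
    unfolding I_def
    by (rule ring.genideal_minimal[OF ring_from_type_algebra]) (auto simp: nf_equation)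
  then show "p \<in> I \<Longrightarrow> poly_eval Const nf p = 0" by blast
qed

text \<open>A homomorphism that annihilates the ideal does not see the difference between a polynomial
  and its normal form. Applied to the quotient ring it shows that the kernel of the normal form lies
  in the ideal; applied to the quotient field it expresses residues by free indeterminates.\<close>

lemma nf_cong:
  assumes "type_ring_hom L \<pi>" and vanish: "\<And>p. p \<in> I \<Longrightarrow> \<pi> p = \<zero>\<^bsub>L\<^esub>"
  shows "\<pi> (poly_eval Const nf p) = \<pi> p"
proof -
  interpret type_ring_hom L \<pi> by fact
  have "\<pi> (nf v) = \<pi> (Var v)" for v
  proof (induction v rule: rank_induct)
    case (free v)
    then show ?case by (simp add: nf_free)
  next
    case (lead g)
    have "\<pi> (poly_eval Const nf (tail g)) = \<pi> (poly_eval Const Var (tail g))"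
      using lead.IH by (intro pi_poly_eval_cong)
    then have "\<pi> (nf (lead g)) = \<pi> (Const (- inverse (lc g)) * tail g)"
      by (simp only: nf_lead pi_mult poly_eval_Const_Var)
    moreover have "Var (lead g) - (Const (- inverse (lc g)) * tail g)
        = Const (inverse (lc g)) * equation g"
      using Const_inverse[OF lc_nonzero, of g "Var (lead g)"]
      by (simp add: equation_def Const_uminus algebra_simps)
    ultimately show ?case
      using vanish[OF equation_in_I] by (metis pi_closed pi_eq_iff pi_mult r_null)
  qed
  then have "\<pi> (poly_eval Const nf p) = \<pi> (poly_eval Const Var p)"
    by (intro pi_poly_eval_cong)
  then show ?thesis by (simp add: poly_eval_Const_Var)
qed

lemma in_I_iff: "p \<in> I \<longleftrightarrow> poly_eval Const nf p = 0"
proof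
  assume 0: "poly_eval Const nf p = 0"
  interpret quot: type_ring_hom "R Quot I" "(+>\<^bsub>R\<^esub>) I"
    by (rule ideal_quotient_hom[OF ideal_I])
  have "I +>\<^bsub>R\<^esub> poly_eval Const nf p = I +>\<^bsub>R\<^esub> p"
    by (rule nf_cong[OF quot.type_ring_hom_axioms])
       (simp add: ideal_quotient_eq_zero_iff[OF ideal_I])
  with 0 show "p \<in> I"
    by (metis quot.pi_zero ideal_quotient_eq_zero_iff[OF ideal_I])
qed (rule I_subset_kernel)

text \<open>The normal form embeds the quotient ring into the polynomial ring, which is a domain.\<close>

lemma primeideal_I: "primeideal I R"
proof (rule primeidealI[OF ideal_I])
  show "carrier R \<noteq> I" using in_I_iff[of 1] by auto
  show "a \<in> I \<or> b \<in> I" if "a \<otimes>\<^bsub>R\<^esub> b \<in> I" for a b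
    using that by (simp add: in_I_iff Const.poly_eval_mult)
qed simp

abbreviation L where
  "L \<equiv> quotient_field (R Quot I)"

definition residue :: "('k, 'v) mpoly \<Rightarrow> (('k, 'v) mpoly set \<times> ('k, 'v) mpoly set) set" where
  "residue p = to_quotient_field (R Quot I) (I +>\<^bsub>R\<^esub> p)"

lemma domain_quotient: "domain (R Quot I)"
  by (rule primeideal.quotient_is_domain[OF primeideal_I])

lemma field_L: "field L"
  by (rule domain.quotient_field_is_field[OF domain_quotient])

lemma residue_hom: "type_ring_hom L residue"
proof -
  have "to_quotient_field (R Quot I) \<circ> (+>\<^bsub>R\<^esub>) I \<in> ring_hom R L"
    by (rule ring_hom_trans[OF ideal.rcos_ring_hom[OF ideal_I]
          domain.to_quotient_field_hom[OF domain_quotient]])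
  then have "residue \<in> ring_hom R L"
    by (simp add: residue_def[abs_def] comp_def)
  then show ?thesis
    using domain.quotient_field_is_cring[OF domain_quotient]
    by (simp add: type_ring_hom_def type_ring_hom_axioms_def)
qed

sublocale residue: type_ring_hom L residue
  by (rule residue_hom)

lemma residue_eq_zero_iff: "residue p = \<zero>\<^bsub>L\<^esub> \<longleftrightarrow> p \<in> I"
proof -
  interpret D: domain "R Quot I" by (rule domain_quotient)
  interpret quot: type_ring_hom "R Quot I" "(+>\<^bsub>R\<^esub>) I"
    by (rule ideal_quotient_hom[OF ideal_I])
  have "\<zero>\<^bsub>L\<^esub> = to_quotient_field (R Quot I) \<zero>\<^bsub>R Quot I\<^esub>"
    by (simp add: D.quotient_field_zero to_quotient_field_def)
  then show ?thesis
    by (simp add: residue_def D.to_quotient_field_eq_iff ideal_quotient_eq_zero_iff[OF ideal_I])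
qed

lemma residue_nf: "residue (poly_eval Const nf p) = residue p"
  by (rule nf_cong[OF residue_hom]) (simp add: residue_eq_zero_iff)

text \<open>A polynomial in free indeterminates is its own normal form, so it lies in the ideal only if
  it is zero.\<close>

lemma residue_free_inj:
  assumes "indets p \<subseteq> free" "residue p = \<zero>\<^bsub>L\<^esub>"
  shows "p = 0"
proof -
  have "poly_eval Const nf p = 0" using assms by (simp add: residue_eq_zero_iff in_I_iff)
  moreover have "poly_eval Const nf p = p"
    using assms(1) by (intro poly_eval_Const_fixed) (auto simp: nf_free)
  ultimately show ?thesis by simp
qed

lemma inj_on_residue_Var: "inj_on (\<lambda>v. residue (Var v)) free"
proof (rule inj_onI, rule ccontr)
  fix v w assume "v \<in> free" "w \<in> free" "residue (Var v) = residue (Var w)" "v \<noteq> w"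
  then have "residue (Var v - Var w) = \<zero>\<^bsub>L\<^esub>"
    by (simp only: residue.pi_eq_iff)
  moreover have "indets (Var v - Var w :: ('k, 'v) mpoly) \<subseteq> free"
    using indets_add[of "Var v" "- Var w :: ('k, 'v) mpoly"]
      indets_Var[of v, where 'b = 'k] indets_Var[of w, where 'b = 'k] \<open>v \<in> free\<close> \<open>w \<in> free\<close>
    by simp blast
  ultimately have "Var v - Var w = (0 :: ('k, 'v) mpoly)"
    by (intro residue_free_inj)
  then show False using \<open>v \<noteq> w\<close> by (simp add: Var_eq_iff)
qed

text \<open>A relation between residues of free indeterminates is a polynomial whose indeterminates
  are these residues. Renaming them back to the free indeterminates gives a polynomial in the ideal,
  which vanishes, and the renaming is injective.\<close>

lemma algebraically_independent_free:
  assumes "F \<subseteq> free"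
  shows "algebraically_independent L (\<lambda>c. residue (Const c)) ((\<lambda>v. residue (Var v)) ` F)"
  unfolding algebraically_independent_def
proof (intro allI impI, elim conjE)
  let ?e = "\<lambda>v. residue (Var v)"
  fix p :: "('k, (('k, 'v) mpoly set \<times> ('k, 'v) mpoly set) set) mpoly"
  assume "\<forall>m\<in>Poly_Mapping.keys p. Poly_Mapping.keys m \<subseteq> ?e ` F"
    and eval: "mpoly_eval L (\<lambda>c. residue (Const c)) (\<lambda>b. b) p = \<zero>\<^bsub>L\<^esub>"
  then have p: "indets p \<subseteq> ?e ` F" by (auto simp: indets_def)
  define g where "g = inv_into F ?e"
  have g: "g b \<in> F" "?e (g b) = b" if "b \<in> indets p" for b
    using subsetD[OF p that] inv_into_into[of b ?e F] f_inv_into_f[of b ?e F]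
    unfolding g_def by blast+
  define q where "q = poly_eval Const (\<lambda>b. Var (g b)) p"
  have "mpoly_eval L (\<lambda>c. residue (Const c)) (\<lambda>b. b) p = residue q"
    unfolding q_def by (rule residue.mpoly_eval_hom) (simp add: g(2))
  with eval have "residue q = \<zero>\<^bsub>L\<^esub>" by simp
  moreover have "indets q \<subseteq> free"
    unfolding q_def
  proof (rule indets_poly_eval)
    show "indets (Var (g b) :: ('k, 'v) mpoly) \<subseteq> free" if "b \<in> indets p" for b
      using indets_Var[of "g b"] g(1)[OF that] assms by blast
  qed
  ultimately have "q = 0" by (intro residue_free_inj)
  \<comment> \<open>the inverse renaming recovers \<open>p\<close> from \<open>q\<close>\<close>
  have "p = poly_eval Const (\<lambda>b. Var (?e (g b))) p"
    using g(2) by (intro poly_eval_Const_fixed[symmetric]) simp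
  also have "\<dots> = poly_eval Const (\<lambda>v. Var (?e v)) q"
    by (simp add: q_def Const.poly_eval_subst)
  finally show "p = 0" by (simp add: \<open>q = 0\<close>)
qed

text \<open>The residue of any indeterminate in \<open>S\<close> is the residue of its normal form, a polynomial in the
  free indeterminates of \<open>S\<close>. So the free ones generate the whole field, not only up to algebraic
  elements.\<close>

lemma trdeg_closed_set:
  assumes closed: "\<And>g. lead g \<in> S \<Longrightarrow> indets (tail g) \<subseteq> S" and "finite S"
  shows "has_trdeg L (\<lambda>c. residue (Const c))
    (generate_field L (range (\<lambda>c. residue (Const c)) \<union> (\<lambda>v. residue (Var v)) ` S)) (card (S \<inter> free))"
proof -
  let ?k = "range (\<lambda>c. residue (Const c))" and ?e = "\<lambda>v. residue (Var v)"
  let ?B = "?e ` (S \<inter> free)"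
  let ?K = "generate_field L (?k \<union> ?B)"
  interpret field L by (rule field_L)
  have sub: "subfield ?K L" by (intro generate_field_is_subfield) auto
  have "?e v \<in> ?K" if "v \<in> S" for v
  proof -
    have "poly_eval Const Var (nf v) \<in> {q. residue q \<in> ?K}"
    proof (rule poly_eval_closed; unfold mem_Collect_eq)
      show "residue 0 \<in> ?K" by (metis residue.pi_zero zero_in_generate)
      show "residue (Var w) \<in> ?K" if "w \<in> indets (nf v)" for w
        using indets_nf[of S v] closed \<open>v \<in> S\<close> that by (blast intro: generate_field.incl)
    qed (auto simp: residue.pi_one residue.pi_add residue.pi_mult intro: generate_field.intros)
    moreover have "residue (nf v) = residue (Var v)"
      using residue_nf[of "Var v"] by simp
    ultimately show ?thesis by (simp add: poly_eval_Const_Var)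
  qed
  then have "generate_field L (?k \<union> ?e ` S) \<subseteq> ?K"
    by (intro generate_field_min_subfield1 sub) (auto intro: generate_field.incl)
  then have "transcendence_basis L (\<lambda>c. residue (Const c)) (generate_field L (?k \<union> ?e ` S)) ?B"
    unfolding transcendence_basis_def
    using algebraic_self[OF subfieldE(1)[OF sub]]
    by (auto simp: over_def intro: generate_field.incl algebraically_independent_free)
  moreover have "card ?B = card (S \<inter> free)"
    by (rule card_image) (rule inj_on_subset[OF inj_on_residue_Var], auto)
  ultimately show ?thesis
    using \<open>finite S\<close> unfolding has_trdeg_def by blast
qed

end

section \<open>Shifts of difference polynomials\<close>

lemma field_automorphism_inverse:
  assumes "field_automorphism f"
  shows "field_automorphism (inv_into UNIV f)"
proof -
  have f: "bij f" "f 1 = 1" "\<And>x y. f (x + y) = f x + f y" "\<And>x y. f (x * y) = f x * f y"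
    using assms by (auto simp: field_automorphism_def)
  let ?g = "inv_into UNIV f"
  have inj: "inj f" and fg: "f (?g x) = x" for x
    using f(1) by (auto simp: bij_def surj_f_inv_f)
  have "?g 1 = 1" by (rule injD[OF inj]) (simp add: fg f)
  moreover have "?g (x + y) = ?g x + ?g y" "?g (x * y) = ?g x * ?g y" for x y
    by (rule injD[OF inj]; simp add: fg f)+
  ultimately show ?thesis using f(1) by (simp add: field_automorphism_def bij_imp_bij_inv)
qed

lemma field_automorphism_comp:
  "field_automorphism f \<Longrightarrow> field_automorphism g \<Longrightarrow> field_automorphism (f \<circ> g)"
  by (auto simp: field_automorphism_def intro: bij_comp)

lemma field_automorphism_funpow: "field_automorphism f \<Longrightarrow> field_automorphism (f ^^ n)"
  by (induction n) (simp_all add: field_automorphism_comp, simp add: field_automorphism_def)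

lemma field_automorphism_shift_coeff:
  assumes "inversive_difference_field \<alpha>1 \<alpha>2"
  shows "field_automorphism (shift_coeff \<alpha>1 \<alpha>2 \<gamma>)"
  using assms unfolding inversive_difference_field_def shift_coeff_def int_iterate_def
  by (auto intro!: field_automorphism_comp field_automorphism_funpow field_automorphism_inverse)

lemma shift_poly_eq_poly_eval:
  "shift_poly \<alpha>1 \<alpha>2 \<gamma> p =
    poly_eval (\<lambda>c. Const (shift_coeff \<alpha>1 \<alpha>2 \<gamma> c)) (\<lambda>v. Var (\<gamma> + fst v, snd v)) p"
  by (simp add: shift_poly_def poly_eval_def monom_eval_def)

text \<open>Zero coefficients are allowed, so that one set \<open>D\<close> serves all variants of a scheme.\<close>

definition affine_form ::
    "shift set \<Rightarrow> (shift \<Rightarrow> 'k::field_char_0) \<Rightarrow> 'k \<Rightarrow> ('k, unit) sigma_poly" where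
  "affine_form D coef e = (\<Sum>\<delta>\<in>D. Const (coef \<delta>) * Var (\<delta>, ())) + Const e"

lemma shift_poly_affine_form:
  assumes "inversive_difference_field \<alpha>1 \<alpha>2"
  shows "shift_poly \<alpha>1 \<alpha>2 \<gamma> (affine_form D coef e) =
    (\<Sum>\<delta>\<in>D. Const (shift_coeff \<alpha>1 \<alpha>2 \<gamma> (coef \<delta>)) * Var (\<gamma> + \<delta>, ())) +
    Const (shift_coeff \<alpha>1 \<alpha>2 \<gamma> e)"
proof -
  interpret coefficient_hom "\<lambda>c. Const (shift_coeff \<alpha>1 \<alpha>2 \<gamma> c)"
    using field_automorphism_shift_coeff[OF assms, of \<gamma>]
    by unfold_locales (simp_all add: field_automorphism_def Const_add Const_mult_Const)
  show ?thesis
    by (simp add: shift_poly_eq_poly_eval affine_form_def poly_eval_simps)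
qed

lemma finite_shift_ball: "finite (shift_ball r)"
proof (rule finite_subset)
  show "shift_ball r \<subseteq> {- int r..int r} \<times> {- int r..int r}"
    by (auto simp: shift_ball_def shift_ord_def)
qed simp

text \<open>The shift \<open>\<gamma> A\<close> is solved for its term at \<open>\<gamma> + corner \<gamma>\<close>, and \<open>F\<close> is the set of free
  points. The assumption on \<open>ord\<close> makes every ball closed under elimination. It admits ties, so
  that termination of the elimination needs a separate \<open>weight\<close>.\<close>

lemma dimension_polynomial_affine_form:
  fixes \<alpha>1 \<alpha>2 :: "'k::field_char_0 \<Rightarrow> 'k" and corner :: "shift \<Rightarrow> shift"
    and weight :: "shift \<Rightarrow> nat"
  defines "F \<equiv> - range (\<lambda>\<gamma>. \<gamma> + corner \<gamma>)"
  assumes K: "inversive_difference_field \<alpha>1 \<alpha>2" and "finite D"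
    and corner: "\<And>\<gamma>. corner \<gamma> \<in> D" "\<And>\<gamma>. coef (corner \<gamma>) \<noteq> 0"
    and inj: "inj (\<lambda>\<gamma>. \<gamma> + corner \<gamma>)"
    and weight: "\<And>\<gamma> \<delta>. \<delta> \<in> D \<Longrightarrow> \<delta> \<noteq> corner \<gamma> \<Longrightarrow> weight (\<gamma> + \<delta>) < weight (\<gamma> + corner \<gamma>)"
    and ord: "\<And>\<gamma> \<delta>. \<delta> \<in> D \<Longrightarrow> shift_ord (\<gamma> + \<delta>) \<le> shift_ord (\<gamma> + corner \<gamma>)"
    and count: "\<forall>\<^sub>F r in sequentially. poly \<psi> (of_nat r) = of_nat (card (shift_ball r \<inter> F))"
  shows "has_dimension_polynomial \<alpha>1 \<alpha>2 {affine_form D coef e} \<psi>"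
proof -
  let ?A = "affine_form D coef e" and ?s = "shift_coeff \<alpha>1 \<alpha>2"
  define lead where "lead \<gamma> = (\<gamma> + corner \<gamma>, ())" for \<gamma>
  define lc where "lc \<gamma> = ?s \<gamma> (coef (corner \<gamma>))" for \<gamma>
  define tail where "tail \<gamma> =
    (\<Sum>\<delta>\<in>D - {corner \<gamma>}. Const (?s \<gamma> (coef \<delta>)) * Var (\<gamma> + \<delta>, ())) + Const (?s \<gamma> e)" for \<gamma>
  have indets_tail: "\<exists>\<delta>\<in>D - {corner \<gamma>}. v = (\<gamma> + \<delta>, ())" if "v \<in> indets (tail \<gamma>)" for v \<gamma>
  proof -
    let ?t = "\<lambda>\<delta>. Const (?s \<gamma> (coef \<delta>)) * Var (\<gamma> + \<delta>, ()) :: ('k, unit) sigma_poly"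
    have "indets (?t \<delta>) \<subseteq> {(\<gamma> + \<delta>, ())}" for \<delta>
      by (rule order_trans[OF indets_mult]) (use indets_Var in simp)
    then have "indets (\<Sum>\<delta>\<in>D - {corner \<gamma>}. ?t \<delta>) \<subseteq> (\<Union>\<delta>\<in>D - {corner \<gamma>}. {(\<gamma> + \<delta>, ())})"
      by (intro order_trans[OF indets_sum] UN_mono) auto
    then have "indets (tail \<gamma>) \<subseteq> (\<Union>\<delta>\<in>D - {corner \<gamma>}. {(\<gamma> + \<delta>, ())})"
      unfolding tail_def by (intro order_trans[OF indets_add]) simp
    with that show ?thesis by blast
  qed
  interpret triangular_system lead lc tail "\<lambda>v. weight (fst v)"
  proof
    show "inj lead" using inj by (auto simp: lead_def inj_def)
    show "lc \<gamma> \<noteq> 0" for \<gamma>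
    proof
      assume 0: "lc \<gamma> = 0"
      have aut: "field_automorphism (?s \<gamma>)" by (rule field_automorphism_shift_coeff[OF K])
      then have "?s \<gamma> (0 + 0) = ?s \<gamma> 0 + ?s \<gamma> 0" unfolding field_automorphism_def by blast
      then have "?s \<gamma> 0 = 0" by simp
      then have "coef (corner \<gamma>) = 0"
        using 0 aut unfolding lc_def field_automorphism_def bij_def by (metis injD)
      then show False using corner(2) by simp
    qed
    fix v \<gamma> assume "v \<in> indets (tail \<gamma>)"
    then obtain \<delta> where "\<delta> \<in> D" "\<delta> \<noteq> corner \<gamma>" "v = (\<gamma> + \<delta>, ())" using indets_tail by blast
    then show "weight (fst v) < weight (fst (lead \<gamma>))"
      using weight[of \<delta> \<gamma>] by (simp add: lead_def)
  qed
  have "equation \<gamma> = shift_poly \<alpha>1 \<alpha>2 \<gamma> ?A" for \<gamma>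
    unfolding equation_def shift_poly_affine_form[OF K] lc_def lead_def tail_def
      sum.remove[OF \<open>finite D\<close> corner(1)[of \<gamma>]] by (simp only: add.assoc)
  then have I: "sigma_ideal \<alpha>1 \<alpha>2 {?A} = I"
    unfolding sigma_ideal_def I_def by (intro arg_cong[of _ _ "genideal _"]) auto
  have residue: "system_map \<alpha>1 \<alpha>2 {?A} p = residue p" for p
    by (simp add: system_map_def system_ring_def residue_def I)
  have free: "free = F \<times> UNIV"
    by (auto simp: free_def F_def lead_def)
  have trdeg: "has_trdeg (quotient_field (system_ring \<alpha>1 \<alpha>2 {?A}))
      (\<lambda>c. system_map \<alpha>1 \<alpha>2 {?A} (Const c)) (ball_field \<alpha>1 \<alpha>2 {?A} r)
      (card (shift_ball r \<inter> F))" for r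
  proof -
    let ?S = "shift_ball r \<times> (UNIV :: unit set)"
    have "indets (tail \<gamma>) \<subseteq> ?S" if "lead \<gamma> \<in> ?S" for \<gamma>
    proof
      fix v assume "v \<in> indets (tail \<gamma>)"
      then obtain \<delta> where "\<delta> \<in> D" "\<delta> \<noteq> corner \<gamma>" "v = (\<gamma> + \<delta>, ())" using indets_tail by blast
      then show "v \<in> ?S"
        using ord[of \<delta> \<gamma>] that by (auto simp: shift_ball_def lead_def)
    qed
    moreover have "card (?S \<inter> free) = card (shift_ball r \<inter> F)"
      by (simp add: free Times_Int_Times card_cartesian_product)
    moreover have "{residue (Var (\<gamma>, i)) |\<gamma> i. \<gamma> \<in> shift_ball r} = (\<lambda>v. residue (Var v)) ` ?S"
      by auto
    ultimately show ?thesis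
      using trdeg_closed_set[of ?S] finite_shift_ball[of r]
      unfolding ball_field_def residue system_ring_def I by simp
  qed
  have "prime_system \<alpha>1 \<alpha>2 {?A}"
    unfolding prime_system_def I using primeideal_I by simp
  moreover have "\<forall>\<^sub>F r in sequentially. \<exists>d.
      has_trdeg (quotient_field (system_ring \<alpha>1 \<alpha>2 {?A}))
        (\<lambda>c. system_map \<alpha>1 \<alpha>2 {?A} (Const c)) (ball_field \<alpha>1 \<alpha>2 {?A} r) d \<and>
      poly \<psi> (of_nat r) = of_nat d"
    using count by (rule eventually_mono) (use trdeg in blast)
  ultimately show ?thesis
    unfolding has_dimension_polynomial_def by (rule conjI)
qed

section \<open>The three difference schemes\<close>

lemma shift_ord_less_iff:
  "shift_ord u < shift_ord v \<longleftrightarrow> \<bar>fst u\<bar> + \<bar>snd u\<bar> < \<bar>fst v\<bar> + \<bar>snd v\<bar>"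
  by (auto simp: shift_ord_def)

lemma shift_ord_le_iff:
  "shift_ord u \<le> shift_ord v \<longleftrightarrow> \<bar>fst u\<bar> + \<bar>snd u\<bar> \<le> \<bar>fst v\<bar> + \<bar>snd v\<bar>"
  unfolding shift_ord_def by (simp add: nat_le_eq_zle)

lemma forward_scheme_eq:
  "forward_scheme a = affine_form {(2, 0), (1, 0), (0, 1), (0, 0)}
    (\<lambda>\<delta>. if \<delta> = (2, 0) then a else if \<delta> = (1, 0) then - 2 * a
         else if \<delta> = (0, 1) then - 1 else a + 1) 0"
  by (simp add: forward_scheme_def affine_form_def Const_uminus algebra_simps)

text \<open>The support of the scheme has the corners \<open>(2, 0)\<close>, \<open>(0, 1)\<close> and \<open>(0, 0)\<close>, with
  coefficients \<open>a\<close>, \<open>- 1\<close> and \<open>a + 1\<close>. Moving right uses the first; on the left the equation is solved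
  upwards from row \<open>0\<close> by the second and downwards by the third. This is where \<open>a \<noteq> - 1\<close> enters.\<close>

lemma dimension_polynomial_forward:
  assumes K: "inversive_difference_field \<alpha>1 \<alpha>2" and "a \<noteq> 0" "a \<noteq> - 1"
  shows "has_dimension_polynomial \<alpha>1 \<alpha>2 {forward_scheme a} [:0, 5:]"
proof -
  define corner :: "shift \<Rightarrow> shift" where
    "corner \<gamma> = (if fst \<gamma> \<ge> 0 then (2, 0) else if snd \<gamma> \<ge> 0 then (0, 1) else (0, 0))" for \<gamma>
  \<comment> \<open>the inverse of \<open>\<gamma> \<mapsto> \<gamma> + corner \<gamma>\<close>\<close>
  define center :: "shift \<Rightarrow> shift" where
    "center w = (if fst w \<ge> 2 then w - (2, 0) else if snd w \<ge> 1 then w - (0, 1) else w)" for w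
  have F: "- range (\<lambda>\<gamma>. \<gamma> + corner \<gamma>) = {w. fst w = 0 \<or> fst w = 1 \<or> fst w < 0 \<and> snd w = 0}"
    (is "_ = ?F")
  proof -
    have "w = center w + corner (center w)" if "w \<notin> ?F" for w
      using that by (auto simp: corner_def center_def prod_eq_iff)
    moreover have "\<gamma> + corner \<gamma> \<notin> ?F" for \<gamma>
      by (auto simp: corner_def)
    ultimately show ?thesis by blast
  qed
  \<comment> \<open>Some terms have the order of the leading one; they lie in \<open>?F\<close>, hence the weight \<open>0\<close> there.\<close>
  define weight where "weight w = (if w \<in> ?F then 0 else Suc (shift_ord w))" for w
  have dominated: "shift_ord (\<gamma> + \<delta>) \<le> shift_ord (\<gamma> + corner \<gamma>)"
    "\<delta> \<noteq> corner \<gamma> \<Longrightarrow> weight (\<gamma> + \<delta>) < weight (\<gamma> + corner \<gamma>)"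
    if "\<delta> \<in> {(2, 0), (1, 0), (0, 1), (0, 0)}" for \<gamma> \<delta>
  proof -
    obtain i j where \<gamma>: "\<gamma> = (i, j)" by (cases \<gamma>)
    consider "i \<ge> 0" | "i < 0" "j \<ge> 0" | "i < 0" "j < 0" by linarith
    then have "shift_ord (\<gamma> + \<delta>) \<le> shift_ord (\<gamma> + corner \<gamma>) \<and>
        (\<delta> \<noteq> corner \<gamma> \<longrightarrow> weight (\<gamma> + \<delta>) < weight (\<gamma> + corner \<gamma>))"
      using that
      by cases (auto simp: \<gamma> corner_def weight_def shift_ord_less_iff shift_ord_le_iff)
    then show "shift_ord (\<gamma> + \<delta>) \<le> shift_ord (\<gamma> + corner \<gamma>)"
      "\<delta> \<noteq> corner \<gamma> \<Longrightarrow> weight (\<gamma> + \<delta>) < weight (\<gamma> + corner \<gamma>)"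
      by blast+
  qed
  have card: "card (shift_ball r \<inter> ?F) = 5 * r" if "r \<ge> 1" for r
  proof -
    have "shift_ball r \<inter> ?F =
        {0} \<times> {- int r..int r} \<union> {1} \<times> {1 - int r..int r - 1} \<union> {- int r..-1} \<times> {0}"
      using that by (auto simp: shift_ball_def shift_ord_def)
    then show ?thesis
      using that by (simp add: card_Un_disjoint card_cartesian_product disjoint_iff)
  qed
  show ?thesis
    unfolding forward_scheme_eq
  proof (rule dimension_polynomial_affine_form[OF K, where corner = corner and weight = weight])
    show "inj (\<lambda>\<gamma>. \<gamma> + corner \<gamma>)"
    proof (rule inj_on_inverseI[where g = center])
      show "center (\<gamma> + corner \<gamma>) = \<gamma>" for \<gamma>
        by (auto simp: corner_def center_def prod_eq_iff)
    qed
    show "\<forall>\<^sub>F r in sequentially. poly [:0, 5:] (of_nat r :: rat) =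
        of_nat (card (shift_ball r \<inter> - range (\<lambda>\<gamma>. \<gamma> + corner \<gamma>)))"
      using eventually_ge_at_top[of 1] by eventually_elim (simp add: F card mult.commute)
    show "weight (\<gamma> + \<delta>) < weight (\<gamma> + corner \<gamma>)"
      if "\<delta> \<in> {(2, 0), (1, 0), (0, 1), (0, 0)}" "\<delta> \<noteq> corner \<gamma>" for \<gamma> \<delta>
      using that by (rule dominated(2))
    show "shift_ord (\<gamma> + \<delta>) \<le> shift_ord (\<gamma> + corner \<gamma>)"
      if "\<delta> \<in> {(2, 0), (1, 0), (0, 1), (0, 0)}" for \<gamma> \<delta>
      using that by (rule dominated(1))
  qed (use assms in \<open>auto simp: corner_def add_eq_0_iff2\<close>)
qed

lemma symmetric_scheme_eq:
  "symmetric_scheme a = affine_form {(1, 0), (-1, 0), (0, 1), (0, -1), (0, 0)}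
    (\<lambda>\<delta>. if \<delta> = (0, 1) then - 1 else if \<delta> = (0, -1) then 1
         else if \<delta> = (0, 0) then - 2 * a else a) 0"
  by (simp add: symmetric_scheme_def affine_form_def Const_uminus algebra_simps)

text \<open>The scheme is of second order in \<open>t\<close> with unit coefficients at \<open>(0, 1)\<close> and \<open>(0, -1)\<close>. The
  two rows \<open>0\<close> and \<open>1\<close> are initial data from which all rows above and below are computed.\<close>

lemma dimension_polynomial_symmetric:
  assumes K: "inversive_difference_field \<alpha>1 \<alpha>2"
  shows "has_dimension_polynomial \<alpha>1 \<alpha>2 {symmetric_scheme a} [:0, 4:]"
proof -
  define corner :: "shift \<Rightarrow> shift" where
    "corner \<gamma> = (if snd \<gamma> \<ge> 1 then (0, 1) else (0, -1))" for \<gamma>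
  define center :: "shift \<Rightarrow> shift" where
    "center w = (if snd w \<ge> 2 then w - (0, 1) else w - (0, -1))" for w
  have F: "- range (\<lambda>\<gamma>. \<gamma> + corner \<gamma>) = {w. snd w = 0 \<or> snd w = 1}"
    (is "_ = ?F")
  proof -
    have "w = center w + corner (center w)" if "w \<notin> ?F" for w
      using that by (auto simp: corner_def center_def prod_eq_iff)
    moreover have "\<gamma> + corner \<gamma> \<notin> ?F" for \<gamma>
      by (auto simp: corner_def)
    ultimately show ?thesis by blast
  qed
  \<comment> \<open>twice the distance from the line between the rows \<open>0\<close> and \<open>1\<close>;
    the order cannot serve here, as it is the same at \<open>\<gamma> + (1, 0)\<close> and \<open>\<gamma> + (0, 1)\<close> if
    \<open>fst \<gamma> \<ge> 0\<close> and \<open>snd \<gamma> \<ge> 0\<close>\<close>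
  define weight where "weight w = nat \<bar>2 * snd w - 1\<bar>" for w :: shift
  have dominated: "shift_ord (\<gamma> + \<delta>) \<le> shift_ord (\<gamma> + corner \<gamma>)"
    "\<delta> \<noteq> corner \<gamma> \<Longrightarrow> weight (\<gamma> + \<delta>) < weight (\<gamma> + corner \<gamma>)"
    if "\<delta> \<in> {(1, 0), (-1, 0), (0, 1), (0, -1), (0, 0)}" for \<gamma> \<delta>
  proof -
    obtain i j where \<gamma>: "\<gamma> = (i, j)" by (cases \<gamma>)
    consider "j \<ge> 1" | "j \<le> 0" by linarith
    then have "shift_ord (\<gamma> + \<delta>) \<le> shift_ord (\<gamma> + corner \<gamma>) \<and>
        (\<delta> \<noteq> corner \<gamma> \<longrightarrow> weight (\<gamma> + \<delta>) < weight (\<gamma> + corner \<gamma>))"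
      using that
      by cases (auto simp: \<gamma> corner_def weight_def shift_ord_less_iff shift_ord_le_iff)
    then show "shift_ord (\<gamma> + \<delta>) \<le> shift_ord (\<gamma> + corner \<gamma>)"
      "\<delta> \<noteq> corner \<gamma> \<Longrightarrow> weight (\<gamma> + \<delta>) < weight (\<gamma> + corner \<gamma>)"
      by blast+
  qed
  have card: "card (shift_ball r \<inter> ?F) = 4 * r" if "r \<ge> 1" for r
  proof -
    have "shift_ball r \<inter> ?F = {- int r..int r} \<times> {0} \<union> {1 - int r..int r - 1} \<times> {1}"
      using that by (auto simp: shift_ball_def shift_ord_def)
    then show ?thesis
      using that by (simp add: card_Un_disjoint card_cartesian_product disjoint_iff)
  qed
  show ?thesis
    unfolding symmetric_scheme_eq
  proof (rule dimension_polynomial_affine_form[OF K, where corner = corner and weight = weight])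
    show "inj (\<lambda>\<gamma>. \<gamma> + corner \<gamma>)"
    proof (rule inj_on_inverseI[where g = center])
      show "center (\<gamma> + corner \<gamma>) = \<gamma>" for \<gamma>
        by (auto simp: corner_def center_def prod_eq_iff)
    qed
    show "\<forall>\<^sub>F r in sequentially. poly [:0, 4:] (of_nat r :: rat) =
        of_nat (card (shift_ball r \<inter> - range (\<lambda>\<gamma>. \<gamma> + corner \<gamma>)))"
      using eventually_ge_at_top[of 1] by eventually_elim (simp add: F card mult.commute)
    show "weight (\<gamma> + \<delta>) < weight (\<gamma> + corner \<gamma>)"
      if "\<delta> \<in> {(1, 0), (-1, 0), (0, 1), (0, -1), (0, 0)}" "\<delta> \<noteq> corner \<gamma>" for \<gamma> \<delta>
      using that by (rule dominated(2))
    show "shift_ord (\<gamma> + \<delta>) \<le> shift_ord (\<gamma> + corner \<gamma>)"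
      if "\<delta> \<in> {(1, 0), (-1, 0), (0, 1), (0, -1), (0, 0)}" for \<gamma> \<delta>
      using that by (rule dominated(1))
  qed (auto simp: corner_def)
qed

abbreviation crank_nicholson_support :: "shift set" where
  "crank_nicholson_support \<equiv> {(1, 1), (-1, 1), (1, 0), (0, 1), (-1, 0), (0, 0)}"

text \<open>In each quadrant the equation is solved for the corner of the support that points away from
  the origin.\<close>

lemma dimension_polynomial_crank_nicholson_support:
  assumes K: "inversive_difference_field \<alpha>1 \<alpha>2"
    and nz: "coef (1, 1) \<noteq> 0" "coef (-1, 1) \<noteq> 0" "coef (1, 0) \<noteq> 0" "coef (-1, 0) \<noteq> 0"
  shows "has_dimension_polynomial \<alpha>1 \<alpha>2 {affine_form crank_nicholson_support coef e} [:-1, 6:]"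
proof -
  define corner :: "shift \<Rightarrow> shift" where
    "corner \<gamma> = (if fst \<gamma> \<ge> 0 then 1 else -1, if snd \<gamma> \<ge> 0 then 1 else 0)" for \<gamma>
  define center :: "shift \<Rightarrow> shift" where
    "center w = w - (if fst w \<ge> 1 then 1 else -1, if snd w \<ge> 1 then 1 else 0)" for w
  have F: "- range (\<lambda>\<gamma>. \<gamma> + corner \<gamma>) = {w. fst w = 0 \<or> fst w = -1 \<or> snd w = 0}"
    (is "_ = ?F")
  proof -
    have "w = center w + corner (center w)" if "w \<notin> ?F" for w
      using that by (auto simp: corner_def center_def prod_eq_iff)
    moreover have "\<gamma> + corner \<gamma> \<notin> ?F" for \<gamma>
      by (auto simp: corner_def)
    ultimately show ?thesis by blast
  qed
  \<comment> \<open>Some terms have the order of the leading one; they lie in \<open>?F\<close>, hence the weight \<open>0\<close> there.\<close>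
  define weight where "weight w = (if w \<in> ?F then 0 else Suc (shift_ord w))" for w
  have dominated: "shift_ord (\<gamma> + \<delta>) \<le> shift_ord (\<gamma> + corner \<gamma>)"
    "\<delta> \<noteq> corner \<gamma> \<Longrightarrow> weight (\<gamma> + \<delta>) < weight (\<gamma> + corner \<gamma>)"
    if "\<delta> \<in> crank_nicholson_support" for \<gamma> \<delta>
  proof -
    obtain i j where \<gamma>: "\<gamma> = (i, j)" by (cases \<gamma>)
    consider "i \<ge> 0" "j \<ge> 0" | "i \<ge> 0" "j < 0" | "i < 0" "j \<ge> 0" | "i < 0" "j < 0" by linarith
    then have "shift_ord (\<gamma> + \<delta>) \<le> shift_ord (\<gamma> + corner \<gamma>) \<and>
        (\<delta> \<noteq> corner \<gamma> \<longrightarrow> weight (\<gamma> + \<delta>) < weight (\<gamma> + corner \<gamma>))"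
      using that
      by cases (auto simp: \<gamma> corner_def weight_def shift_ord_less_iff shift_ord_le_iff)
    then show "shift_ord (\<gamma> + \<delta>) \<le> shift_ord (\<gamma> + corner \<gamma>)"
      "\<delta> \<noteq> corner \<gamma> \<Longrightarrow> weight (\<gamma> + \<delta>) < weight (\<gamma> + corner \<gamma>)"
      by blast+
  qed
  have card: "card (shift_ball r \<inter> ?F) = 6 * r - 1" if "r \<ge> 1" for r
  proof -
    have "shift_ball r \<inter> ?F =
        {0} \<times> {- int r..int r} \<union> {-1} \<times> {1 - int r..int r - 1} \<union>
        {1..int r} \<times> {0} \<union> {- int r..-2} \<times> {0}"
      using that by (auto simp: shift_ball_def shift_ord_def)
    then show ?thesis
      using that by (simp add: card_Un_disjoint card_cartesian_product disjoint_iff)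
  qed
  show ?thesis
  proof (rule dimension_polynomial_affine_form[OF K, where corner = corner and weight = weight])
    show "inj (\<lambda>\<gamma>. \<gamma> + corner \<gamma>)"
    proof (rule inj_on_inverseI[where g = center])
      show "center (\<gamma> + corner \<gamma>) = \<gamma>" for \<gamma>
        by (auto simp: corner_def center_def prod_eq_iff)
    qed
    show "\<forall>\<^sub>F r in sequentially. poly [:-1, 6:] (of_nat r :: rat) =
        of_nat (card (shift_ball r \<inter> - range (\<lambda>\<gamma>. \<gamma> + corner \<gamma>)))"
      using eventually_ge_at_top[of 1] by eventually_elim (simp add: F card of_nat_diff mult.commute)
    show "weight (\<gamma> + \<delta>) < weight (\<gamma> + corner \<gamma>)"
      if "\<delta> \<in> crank_nicholson_support" "\<delta> \<noteq> corner \<gamma>" for \<gamma> \<delta>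
      using that by (rule dominated(2))
    show "shift_ord (\<gamma> + \<delta>) \<le> shift_ord (\<gamma> + corner \<gamma>)"
      if "\<delta> \<in> crank_nicholson_support" for \<gamma> \<delta>
      using that by (rule dominated(1))
  qed (use nz in \<open>auto simp: corner_def\<close>)
qed

text \<open>One formula covers both readings of the last term: \<open>a5 y\<close> for \<open>e = 0\<close>, and a constant
  term \<open>e\<close> for \<open>a5 = 0\<close>. The factor \<open>c\<close> relates the form to the scheme before normalization.\<close>

lemma crank_nicholson_form_eq:
  "Const c * crank_nicholson_form a1 a2 a3 a4 (Const a5 * Y 0 0 + Const e) =
    affine_form crank_nicholson_support
      (\<lambda>\<delta>. c * (if \<delta> = (1, 1) then 1 else if \<delta> = (-1, 1) then a1 else if \<delta> = (1, 0) then a2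
         else if \<delta> = (0, 1) then a3 else if \<delta> = (-1, 0) then a4 else a5)) (c * e)"
  by (simp add: crank_nicholson_form_def affine_form_def ring_distribs add_ac zero_prod_def
      flip: Const_mult_Const mult.assoc)

lemma dimension_polynomial_crank_nicholson_form:
  assumes "inversive_difference_field \<alpha>1 \<alpha>2" "c \<noteq> 0" "a1 \<noteq> 0" "a2 \<noteq> 0" "a4 \<noteq> 0"
  shows "has_dimension_polynomial \<alpha>1 \<alpha>2
    {Const c * crank_nicholson_form a1 a2 a3 a4 (Const a5 * Y 0 0 + Const e)} [:-1, 6:]"
  unfolding crank_nicholson_form_eq
  by (rule dimension_polynomial_crank_nicholson_support) (use assms in auto)

text \<open>Normalization of the scheme by its coefficient \<open>- a / 2\<close> at \<open>\<alpha>1 \<alpha>2 y\<close>.\<close>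

lemma crank_nicholson_scheme_eq:
  assumes "a \<noteq> 0"
  shows "crank_nicholson_scheme (a :: 'k::field_char_0) = Const (- a / 2) *
    crank_nicholson_form 1 1 (- 2 * (1 + a) / a) 1 (Const (2 * (1 - a) / a) * Y 0 0)"
proof -
  have numeral: "Const (numeral n) = (numeral n :: ('k, unit) sigma_poly)" for n
    by (simp add: Const_def)
  have 1: "Const a = Const (a / 2) * (2 :: ('k, unit) sigma_poly)"
    by (simp add: Const_mult_Const flip: numeral)
  have c: "- a / 2 * (- 2 * (1 + a) / a) = 1 + a" "- a / 2 * (2 * (1 - a) / a) = a - 1"
    using assms by (simp_all add: field_simps)
  have 2: "Const (- a / 2) * (Const (- 2 * (1 + a) / a) * p) = (1 + Const a) * p"
    "Const (- a / 2) * (Const (2 * (1 - a) / a) * p) = (Const a - 1) * p"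
    for p :: "('k, unit) sigma_poly"
    unfolding mult.assoc[symmetric] Const_mult_Const c by (simp_all add: Const_add Const_diff)
  show ?thesis
    unfolding crank_nicholson_scheme_def crank_nicholson_form_def
      distrib_left[of "Const (- a / 2) :: ('k, unit) sigma_poly"] 2
    by (simp add: Const_uminus 1 algebra_simps)
qed

lemma is_constant_intros:
  assumes K: "inversive_difference_field \<alpha>1 \<alpha>2"
  shows "is_constant \<alpha>1 \<alpha>2 1" "is_constant \<alpha>1 \<alpha>2 0"
    and "is_constant \<alpha>1 \<alpha>2 a \<Longrightarrow> is_constant \<alpha>1 \<alpha>2 b \<Longrightarrow> is_constant \<alpha>1 \<alpha>2 (a + b)"
    and "is_constant \<alpha>1 \<alpha>2 a \<Longrightarrow> is_constant \<alpha>1 \<alpha>2 b \<Longrightarrow> is_constant \<alpha>1 \<alpha>2 (a * b)"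
    and "is_constant \<alpha>1 \<alpha>2 a \<Longrightarrow> is_constant \<alpha>1 \<alpha>2 (- a)"
    and "is_constant \<alpha>1 \<alpha>2 a \<Longrightarrow> is_constant \<alpha>1 \<alpha>2 (inverse a)"
proof -
  have aut: "f 1 = 1" "f 0 = 0" "f (x + y) = f x + f y" "f (x * y) = f x * f y" "f (- x) = - f x"
    "f (inverse x) = inverse (f x)"
    if "field_automorphism f" for f :: "'a \<Rightarrow> 'a" and x y
  proof -
    have f: "f 1 = 1" "\<And>x y. f (x + y) = f x + f y" "\<And>x y. f (x * y) = f x * f y"
      using that by (auto simp: field_automorphism_def)
    have 0: "f 0 = 0" using f(2)[of 0 0] by simp
    show "f 1 = 1" "f 0 = 0" "f (x + y) = f x + f y" "f (x * y) = f x * f y" by (fact f 0)+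
    show "f (- x) = - f x" using f(2)[of x "- x"] by (simp add: 0 eq_neg_iff_add_eq_0 add.commute)
    show "f (inverse x) = inverse (f x)"
    proof (cases "x = 0")
      case False
      then have "f x * f (inverse x) = 1" by (simp add: f(1) flip: f(3))
      then show ?thesis by (metis inverse_unique)
    qed (simp add: 0)
  qed
  note simps = aut[of \<alpha>1] aut[of \<alpha>2]
  have K': "field_automorphism \<alpha>1" "field_automorphism \<alpha>2"
    using K by (auto simp: inversive_difference_field_def)
  show "is_constant \<alpha>1 \<alpha>2 1" "is_constant \<alpha>1 \<alpha>2 0"
    and "is_constant \<alpha>1 \<alpha>2 a \<Longrightarrow> is_constant \<alpha>1 \<alpha>2 b \<Longrightarrow> is_constant \<alpha>1 \<alpha>2 (a + b)"
    and "is_constant \<alpha>1 \<alpha>2 a \<Longrightarrow> is_constant \<alpha>1 \<alpha>2 b \<Longrightarrow> is_constant \<alpha>1 \<alpha>2 (a * b)"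
    and "is_constant \<alpha>1 \<alpha>2 a \<Longrightarrow> is_constant \<alpha>1 \<alpha>2 (- a)"
    and "is_constant \<alpha>1 \<alpha>2 a \<Longrightarrow> is_constant \<alpha>1 \<alpha>2 (inverse a)"
    by (simp_all add: is_constant_def simps K')
qed

lemma eventually_lessI:
  assumes "\<And>r. r \<ge> 1 \<Longrightarrow> poly f (of_nat r) < poly g (of_nat r)"
  shows "eventually_less f g"
  unfolding eventually_less_def using eventually_ge_at_top[of 1] by eventually_elim (rule assms)

theorem mainTheorem3:
  fixes \<alpha>1 \<alpha>2 :: "'k::field_char_0 \<Rightarrow> 'k" and a :: 'k
  assumes K: "inversive_difference_field \<alpha>1 \<alpha>2"
    and a_const: "is_constant \<alpha>1 \<alpha>2 a" and a_nonzero: "a \<noteq> 0"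
  shows
    "(a \<noteq> -1 \<longrightarrow> has_dimension_polynomial \<alpha>1 \<alpha>2 {forward_scheme a} [:0, 5:])
     \<and>
     has_dimension_polynomial \<alpha>1 \<alpha>2 {symmetric_scheme a} [:0, 4:]
     \<and>
     (\<exists>c a1 a2 a3 a4 a5. c \<noteq> 0 \<and> a1 \<noteq> 0 \<and> a2 \<noteq> 0 \<and> a4 \<noteq> 0 \<and>
        (\<forall>b\<in>{c, a1, a2, a3, a4, a5}. is_constant \<alpha>1 \<alpha>2 b) \<and>
        crank_nicholson_scheme a =
          Const c * crank_nicholson_form a1 a2 a3 a4 (Const a5 * Y 0 0))
     \<and>
     has_dimension_polynomial \<alpha>1 \<alpha>2 {crank_nicholson_scheme a} [:-1, 6:]
     \<and>
     (\<forall>a1 a2 a3 a4 a5.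
        (\<forall>b\<in>{a1, a2, a3, a4, a5}. is_constant \<alpha>1 \<alpha>2 b) \<and> a1 \<noteq> 0 \<and> a2 \<noteq> 0 \<and> a4 \<noteq> 0 \<longrightarrow>
        (\<forall>T\<in>{Const a5, Const a5 * Y 0 0}.
           has_dimension_polynomial \<alpha>1 \<alpha>2 {crank_nicholson_form a1 a2 a3 a4 T} [:-1, 6:] \<and>
           higher_strength \<alpha>1 \<alpha>2 {symmetric_scheme a} {crank_nicholson_form a1 a2 a3 a4 T}))
     \<and>
     (a \<noteq> -1 \<longrightarrow> higher_strength \<alpha>1 \<alpha>2 {symmetric_scheme a} {forward_scheme a})
     \<and>
     higher_strength \<alpha>1 \<alpha>2 {symmetric_scheme a} {crank_nicholson_scheme a}"
proof -
  have forward: "has_dimension_polynomial \<alpha>1 \<alpha>2 {forward_scheme a} [:0, 5:]" if "a \<noteq> -1"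
    by (rule dimension_polynomial_forward[OF K a_nonzero that])
  have symmetric: "has_dimension_polynomial \<alpha>1 \<alpha>2 {symmetric_scheme a} [:0, 4:]"
    by (rule dimension_polynomial_symmetric[OF K])
  have form: "has_dimension_polynomial \<alpha>1 \<alpha>2 {crank_nicholson_form a1 a2 a3 a4 T} [:-1, 6:]"
    if nz: "a1 \<noteq> 0" "a2 \<noteq> 0" "a4 \<noteq> 0" and T: "T \<in> {Const a5, Const a5 * Y 0 0}" for a1 a2 a3 a4 a5 T
  proof -
    obtain b e where "T = Const b * Y 0 0 + Const e"
    proof
      show "T = Const (if T = Const a5 then 0 else a5) * Y 0 0 +
          Const (if T = Const a5 then a5 else 0)"
        using T by auto
    qed
    then show ?thesis
      using dimension_polynomial_crank_nicholson_form[OF K one_neq_zero nz] by simp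
  qed
  have scheme: "has_dimension_polynomial \<alpha>1 \<alpha>2 {crank_nicholson_scheme a} [:-1, 6:]"
    using dimension_polynomial_crank_nicholson_form
        [OF K, of "- a / 2" 1 1 1 "- 2 * (1 + a) / a" "2 * (1 - a) / a" 0] a_nonzero
    by (simp add: crank_nicholson_scheme_eq[OF a_nonzero])
  have "is_constant \<alpha>1 \<alpha>2 (1 + 1)"
    by (intro is_constant_intros K)
  then have two: "is_constant \<alpha>1 \<alpha>2 2" by simp
  have "is_constant \<alpha>1 \<alpha>2 1" "is_constant \<alpha>1 \<alpha>2 (- a / 2)"
    "is_constant \<alpha>1 \<alpha>2 (- 2 * (1 + a) / a)" "is_constant \<alpha>1 \<alpha>2 (2 * (1 - a) / a)"
    unfolding divide_inverse diff_conv_add_uminus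
    by (intro is_constant_intros K a_const two)+
  then have "\<forall>b\<in>{- a / 2, 1, - 2 * (1 + a) / a, 2 * (1 - a) / a}. is_constant \<alpha>1 \<alpha>2 b"
    by blast
  then have normal: "\<exists>c a1 a2 a3 a4 a5. c \<noteq> 0 \<and> a1 \<noteq> 0 \<and> a2 \<noteq> 0 \<and> a4 \<noteq> 0 \<and>
      (\<forall>b\<in>{c, a1, a2, a3, a4, a5}. is_constant \<alpha>1 \<alpha>2 b) \<and>
      crank_nicholson_scheme a = Const c * crank_nicholson_form a1 a2 a3 a4 (Const a5 * Y 0 0)"
    using crank_nicholson_scheme_eq[OF a_nonzero] a_nonzero
    by (intro exI[of _ "- a / 2"] exI[of _ 1] exI[of _ "- 2 * (1 + a) / a"]
        exI[of _ "2 * (1 - a) / a"]) simp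
  have "eventually_less [:0, 4:] [:0, 5:]" "eventually_less [:0, 4:] [:-1, 6:]"
    by (rule eventually_lessI; simp)+
  then show ?thesis
    using forward symmetric form scheme normal unfolding higher_strength_def by blast
qed

end
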